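(* Let $w\in S_n$ have orthodontic sequence $\bm{i}(w)=(i_1,\ldots,i_\ell)$, $\bm{k}(w)=(k_1,\ldots,k_n)$, $\bm{m}(w)=(m_1,\ldots,m_\ell)$. Then \[\mathfrak{G}_w=\omega_1^{k_1}\cdots\omega_n^{k_n}\,\overline{\pi}_{i_1}\bigl(\omega_{i_1}^{m_1}\overline{\pi}_{i_2}\bigl(\omega_{i_2}^{m_2}\cdots\overline{\pi}_{i_\ell}(\omega_{i_\ell}^{m_\ell})\cdots\bigr)\bigr),\] where $\omega_i=x_1x_2\cdots x_i$ is the $i$-th fundamental weight.
   Context: Notation: $[n]=\{1,\ldots,n\}$, $[m,n]=\{m,\ldots,n\}$, $[0]=\emptyset$. For $j\in[n-1]$, $s_j$ is the adjacent transposition; permutations act on the right on positions, so $ws_j$ is $w$ with the values $w(j),w(j+1)$ swapped. Operators on $\mathbb{C}[x_1,\ldots,x_n]$: $\partial_j(f)=\frac{f-s_j f}{x_j-x_{j+1}}$ where $s_jf$ swaps $x_j$ and $x_{j+1}$; $\overline{\partial}_j(f)=\partial_j((1-x_{j+1})f)$; $\overline{\pi}_j(f)=\partial_j(x_j(1-x_{j+1})f)$. Grothendieck polynomials: for $w_0=n\,(n-1)\cdots 1$, $\mathfrak{G}_{w_0}=x_1^{n-1}x_2^{n-2}\cdots x_{n-1}$, and if $w(j)<w(j+1)$ then $\mathfrak{G}_w=\overline{\partial}_j\mathfrak{G}_{ws_j}$. Rothe diagram: $D(w)=\{(i,j)\in[n]^2: i<w^{-1}(j),\ j<w(i)\}$,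 with $(i,j)$ meaning row $i$, column $j$; a diagram $D\subseteq[n]^2$ is viewed as its list of columns $(C_1,\ldots,C_n)$, $C_j=\{i:(i,j)\in D\}$. A missing tooth of a column $C$ is a positive integer $i$ with $i\notin C$, $i+1\in C$; the only columns without missing teeth are the standard intervals $[j]$, $j\ge 0$. Orthodontic sequence: Start with $D=D(w)$. For each $j\in[n]$ let $k_j$ be the number of columns of $D$ equal to $[j]$; replace all these columns by empty columns. If nonempty columns remain, let $i_1$ be the smallest missing tooth of the leftmost nonempty column, and swap rows $i_1$ and $i_1+1$ of the diagram. Then let $m_1$ be the number of columns equal to $[i_1]$ in the new diagram, replace them by empty columns, let $i_2$ be the smallest missing tooth of the leftmost nonempty column, swap rows $i_2,i_2+1$, and so on; at step $r$ one sets $m_r$ = number of columns equal to $[i_r]$ (after the swap of rows $i_r,i_r+1$), empties them, and picks $i_{r+1}$. Stop when no nonempty columns remain, after $\ell$ swaps. The result $\bm{i}(w)=(i_1,\ldots,i_\ell)$, $\bm{k}(w)=(k_1,\ldots,k_n)$, $\bm{m}(w)=(m_1,\ldots,m_\ell)$ is the orthodontic sequence of $w$. *)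

theory Defs
  imports
    Complex_Main
    "HOL-Library.Poly_Mapping"
    "HOL-Combinatorics.Permutations"
begin

section \<open>Polynomials and divided differences\<close>

text \<open>
  Polynomials with complex coefficients in the variables $x_0, x_1, x_2, \ldots$, as finitely
  supported functions from exponent vectors to coefficients. The ring
  $\mathbb{C}[x_1,\ldots,x_n]$ is the subring of polynomials in which only $x_1,\ldots,x_n$ occur.
\<close>

type_synonym cpoly = "(nat \<Rightarrow>\<^sub>0 nat) \<Rightarrow>\<^sub>0 complex"

definition X :: "nat \<Rightarrow> cpoly" where
  "X i = Poly_Mapping.single (Poly_Mapping.single i 1) 1"

definition swap_exp :: "nat \<Rightarrow> (nat \<Rightarrow>\<^sub>0 nat) \<Rightarrow> (nat \<Rightarrow>\<^sub>0 nat)" where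
  "swap_exp j = Poly_Mapping.map_key (transpose j (Suc j))"

definition swap_vars :: "nat \<Rightarrow> cpoly \<Rightarrow> cpoly" where
  "swap_vars j = Poly_Mapping.map_key (swap_exp j)"

text \<open>The quotient exists and is unique; see \<open>divdiff_eq\<close> and \<open>divdiff_unique\<close> below.\<close>

definition divdiff :: "nat \<Rightarrow> cpoly \<Rightarrow> cpoly" where
  "divdiff j f = (THE g. (X j - X (Suc j)) * g = f - swap_vars j f)"

definition divdiff_bar :: "nat \<Rightarrow> cpoly \<Rightarrow> cpoly" where
  "divdiff_bar j f = divdiff j ((1 - X (Suc j)) * f)"

definition demazure_bar :: "nat \<Rightarrow> cpoly \<Rightarrow> cpoly" where
  "demazure_bar j f = divdiff j (X j * (1 - X (Suc j)) * f)"

definition fund_weight :: "nat \<Rightarrow> cpoly" where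
  "fund_weight i = (\<Prod>j=1..i. X j)"

section \<open>Grothendieck polynomials\<close>

definition w0 :: "nat \<Rightarrow> nat \<Rightarrow> nat" where
  "w0 n i = (if i \<in> {1..n} then n + 1 - i else i)"

text \<open>
  The pairs $(w, f)$ reached from $w_0$ by the recursion, through any choice of ascents.
  That $f$ is determined by $w$ is \<open>is_grothendieck_ex1\<close> below.
\<close>

inductive is_grothendieck :: "nat \<Rightarrow> (nat \<Rightarrow> nat) \<Rightarrow> cpoly \<Rightarrow> bool" for n where
  top: "is_grothendieck n (w0 n) (\<Prod>i\<in>{1..<n}. X i ^ (n - i))"
| step: "w permutes {1..n} \<Longrightarrow> j \<in> {1..<n} \<Longrightarrow> w j < w (Suc j) \<Longrightarrow>
    is_grothendieck n (w \<circ> transpose j (Suc j)) f \<Longrightarrow> is_grothendieck n w (divdiff_bar j f)"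

definition grothendieck :: "nat \<Rightarrow> (nat \<Rightarrow> nat) \<Rightarrow> cpoly" where
  "grothendieck n w = (THE f. is_grothendieck n w f)"

section \<open>Orthodontic sequences\<close>

definition rothe :: "nat \<Rightarrow> (nat \<Rightarrow> nat) \<Rightarrow> (nat \<times> nat) set" where
  "rothe n w = {(i, j). i \<in> {1..n} \<and> j \<in> {1..n} \<and> i < inv w j \<and> j < w i}"

definition columns :: "nat \<Rightarrow> (nat \<times> nat) set \<Rightarrow> nat set list" where
  "columns n D = map (\<lambda>j. {i. (i, j) \<in> D}) [1..<Suc n]"

definition missing_tooth :: "nat set \<Rightarrow> nat \<Rightarrow> bool" where
  "missing_tooth C i \<longleftrightarrow> 1 \<le> i \<and> i \<notin> C \<and> Suc i \<in> C"

definition leftmost :: "nat set list \<Rightarrow> nat set" where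
  "leftmost Cs = hd (filter (\<lambda>C. C \<noteq> {}) Cs)"

definition swap_rows :: "nat \<Rightarrow> nat set list \<Rightarrow> nat set list" where
  "swap_rows i Cs = map (\<lambda>C. transpose i (Suc i) ` C) Cs"

definition clear_cols :: "nat set \<Rightarrow> nat set list \<Rightarrow> nat set list" where
  "clear_cols J Cs = map (\<lambda>C. if \<exists>j\<in>J. C = {1..j} then {} else C) Cs"

text \<open>
  The part of the algorithm after the initial removal of standard columns: a run from the
  diagram \<open>Cs\<close> that stops after producing the lists $(i_1,\ldots,i_\ell)$ and
  $(m_1,\ldots,m_\ell)$.
\<close>

inductive orthodontia :: "nat set list \<Rightarrow> nat list \<Rightarrow> nat list \<Rightarrow> bool" where
  stop: "(\<forall>C\<in>set Cs. C = {}) \<Longrightarrow> orthodontia Cs [] []"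
| step: "(\<exists>C\<in>set Cs. C \<noteq> {}) \<Longrightarrow> i = (LEAST i. missing_tooth (leftmost Cs) i) \<Longrightarrow>
    Ds = swap_rows i Cs \<Longrightarrow> m = count_list Ds {1..i} \<Longrightarrow>
    orthodontia (clear_cols {i} Ds) is ms \<Longrightarrow> orthodontia Cs (i # is) (m # ms)"

definition orthodontic_sequence ::
    "nat \<Rightarrow> (nat \<Rightarrow> nat) \<Rightarrow> nat list \<Rightarrow> nat list \<Rightarrow> nat list \<Rightarrow> bool" where
  "orthodontic_sequence n w is ks ms \<longleftrightarrow>
    ks = map (\<lambda>j. count_list (columns n (rothe n w)) {1..j}) [1..<Suc n] \<and>
    orthodontia (clear_cols {1..n} (columns n (rothe n w))) is ms"

section \<open>Well-definedness of divided differences\<close>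

lemma swap_exp_swap_exp [simp]: "swap_exp j (swap_exp j m) = m"
  unfolding swap_exp_def
  by (rule poly_mapping_eqI) (simp add: Poly_Mapping.map_key.rep_eq)

lemma inj_swap_exp [simp]: "inj (swap_exp j)"
  by (rule inj_on_inverseI[where g = "swap_exp j"]) simp

lemma swap_exp_add: "swap_exp j (a + b) = swap_exp j a + swap_exp j b"
  unfolding swap_exp_def by (rule map_key_plus) simp

lemma swap_exp_0 [simp]: "swap_exp j 0 = 0"
  unfolding swap_exp_def by simp

lemma swap_exp_single [simp]:
  "swap_exp j (Poly_Mapping.single k a) = Poly_Mapping.single (transpose j (Suc j) k) a"
  unfolding swap_exp_def
  using map_key_single[of "transpose j (Suc j)" "transpose j (Suc j) k" a] by simp

lemma swap_vars_add: "swap_vars j (p + q) = swap_vars j p + swap_vars j q"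
  unfolding swap_vars_def by (rule map_key_plus) simp

lemma swap_vars_0 [simp]: "swap_vars j 0 = 0"
  unfolding swap_vars_def by simp

lemma swap_vars_single [simp]:
  "swap_vars j (Poly_Mapping.single m c) = Poly_Mapping.single (swap_exp j m) c"
  unfolding swap_vars_def
  using map_key_single[of "swap_exp j" "swap_exp j m" c] by simp

lemma swap_vars_1 [simp]: "swap_vars j 1 = 1"
  using swap_vars_single[of j 0 1] by simp

lemma swap_vars_uminus: "swap_vars j (- p) = - swap_vars j p"
  by (metis add.right_inverse add_eq_0_iff swap_vars_0 swap_vars_add)

lemma swap_vars_diff: "swap_vars j (p - q) = swap_vars j p - swap_vars j q"
  using swap_vars_add[of j p "- q"] by (simp add: swap_vars_uminus)

lemma poly_mapping_plus_single_induct: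
  fixes p :: "'a \<Rightarrow>\<^sub>0 'b::comm_monoid_add"
  assumes "P 0" and "\<And>a c p. P p \<Longrightarrow> P (Poly_Mapping.single a c + p)"
  shows "P p"
proof (induction p rule: update_induct)
  case const
  show ?case by (rule assms(1))
next
  case (update p a c)
  have "Poly_Mapping.update a c p = Poly_Mapping.single a c + p"
    using update.hyps
    by (intro poly_mapping_eqI)
      (auto simp: lookup_update lookup_add lookup_single when_def in_keys_iff)
  then show ?case using assms(2) update by simp
qed

lemma swap_vars_mult: "swap_vars j (p * q) = swap_vars j p * swap_vars j q"
proof (induction p rule: poly_mapping_plus_single_induct)
  case 1
  show ?case by simp
next
  case (2 a c p)
  have "swap_vars j (Poly_Mapping.single a c * q) =
      Poly_Mapping.single (swap_exp j a) c * swap_vars j q"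
    by (induction q rule: poly_mapping_plus_single_induct)
      (simp_all add: algebra_simps swap_vars_add mult_single swap_exp_add)
  with 2 show ?case by (simp add: algebra_simps swap_vars_add)
qed

lemma swap_vars_swap_vars [simp]: "swap_vars j (swap_vars j p) = p"
  by (induction p rule: poly_mapping_plus_single_induct) (simp_all add: swap_vars_add)

lemma swap_vars_X [simp]: "swap_vars j (X i) = X (transpose j (Suc j) i)"
  by (simp add: X_def)

lemmas swap_vars_simps =
  swap_vars_add swap_vars_diff swap_vars_uminus swap_vars_mult

lemma X_eq_iff [simp]: "X i = X j \<longleftrightarrow> i = j"
  by (metis X_def lookup_single_eq lookup_single_not_eq zero_neq_one)

lemma monom_dvd_swap_diff:
  "X j - X (Suc j) dvd
    Poly_Mapping.single m c - Poly_Mapping.single (swap_exp j m) (c :: complex)"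
proof (induction m rule: poly_mapping_plus_single_induct)
  case 1
  show ?case by simp
next
  case (2 i a m)
  let ?d = "X j - X (Suc j)"
  have pow: "Poly_Mapping.single (Poly_Mapping.single k a) 1 = X k ^ a" for k
  proof (induction a)
    case (Suc a)
    have "Poly_Mapping.single (Poly_Mapping.single k (Suc a)) (1::complex) =
        X k * Poly_Mapping.single (Poly_Mapping.single k a) 1"
      by (simp add: X_def mult_single flip: single_add)
    with Suc show ?case by simp
  qed simp
  have split: "Poly_Mapping.single (Poly_Mapping.single k a + m') c =
      X k ^ a * Poly_Mapping.single m' c" for k m'
    by (simp add: mult_single flip: pow)
  have "X i - X (transpose j (Suc j) i) dvd
      X i ^ a - X (transpose j (Suc j) i) ^ a"
    by (metis dvd_triv_left power_diff_sumr2)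
  moreover have "?d dvd X i - X (transpose j (Suc j) i)"
  proof (cases "i = Suc j")
    case True
    then show ?thesis using dvd_minus_iff[of ?d ?d] by simp
  qed (cases "i = j"; simp)
  ultimately have "?d dvd X i ^ a - X (transpose j (Suc j) i) ^ a"
    by (rule dvd_trans[rotated])
  then have "?d dvd (X i ^ a - X (transpose j (Suc j) i) ^ a) * Poly_Mapping.single m c +
      X (transpose j (Suc j) i) ^ a *
      (Poly_Mapping.single m c - Poly_Mapping.single (swap_exp j m) c)"
    using 2 by simp
  then show ?case unfolding swap_exp_add swap_exp_single split by (simp add: algebra_simps)
qed

lemma dvd_swap_diff: "X j - X (Suc j) dvd f - swap_vars j f"
proof (induction f rule: poly_mapping_plus_single_induct)
  case 1
  show ?case by simp
next
  case (2 m c f)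
  show ?case using dvd_add[OF monom_dvd_swap_diff[of j m c] 2]
    by (simp add: swap_vars_add algebra_simps)
qed

lemma divdiff_unique:
  assumes "(X j - X (Suc j)) * g = f - swap_vars j f"
  shows "divdiff j f = g"
  unfolding divdiff_def
proof (rule the_equality[where a = g])
  fix h assume "(X j - X (Suc j)) * h = f - swap_vars j f"
  with assms have "(X j - X (Suc j)) * h = (X j - X (Suc j)) * g" by simp
  then show "h = g" by simp
qed (rule assms)

lemma divdiff_eq: "(X j - X (Suc j)) * divdiff j f = f - swap_vars j f"
proof -
  obtain g where g: "f - swap_vars j f = (X j - X (Suc j)) * g"
    using dvd_swap_diff by (rule dvdE)
  then show ?thesis using divdiff_unique[of j g f] by simp
qed

section \<open>Well-definedness of Grothendieck polynomials\<close>

lemma divdiff_bar_eq: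
  "(X j - X (Suc j)) * divdiff_bar j f = (1 - X (Suc j)) * f - (1 - X j) * swap_vars j f"
  unfolding divdiff_bar_def divdiff_eq by (simp add: swap_vars_simps)

lemma swap_vars_braid:
  "swap_vars j (swap_vars (Suc j) (swap_vars j f)) =
   swap_vars (Suc j) (swap_vars j (swap_vars (Suc j) f))"
proof -
  have *: "transpose j (Suc j) (transpose (Suc j) (Suc (Suc j)) (transpose j (Suc j) i)) =
      transpose (Suc j) (Suc (Suc j)) (transpose j (Suc j)
        (transpose (Suc j) (Suc (Suc j)) i))" for i
    by (auto simp: transpose_def)
  have "swap_exp j (swap_exp (Suc j) (swap_exp j m)) =
      swap_exp (Suc j) (swap_exp j (swap_exp (Suc j) m))" for m
    by (induction m rule: poly_mapping_plus_single_induct) (simp_all add: swap_exp_add *)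
  then show ?thesis
    by (induction f rule: poly_mapping_plus_single_induct) (simp_all add: swap_vars_add)
qed

lemma swap_vars_commute:
  assumes "Suc j < k"
  shows "swap_vars j (swap_vars k f) = swap_vars k (swap_vars j f)"
proof -
  have *: "transpose j (Suc j) (transpose k (Suc k) i) =
      transpose k (Suc k) (transpose j (Suc j) i)" for i
    using assms by (auto simp: transpose_def)
  have "swap_exp j (swap_exp k m) = swap_exp k (swap_exp j m)" for m
    by (induction m rule: poly_mapping_plus_single_induct) (simp_all add: swap_exp_add *)
  then show ?thesis
    by (induction f rule: poly_mapping_plus_single_induct) (simp_all add: swap_vars_add)
qed

lemma divdiff_bar_commute:
  assumes "Suc j < k"
  shows "divdiff_bar j (divdiff_bar k f) = divdiff_bar k (divdiff_bar j f)"
proof -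
  define a b c d where "a = X j" and "b = X (Suc j)" and "c = X k" and "d = X (Suc k)"
  note defs = a_def b_def c_def d_def
  have nz: "a - b \<noteq> 0" "c - d \<noteq> 0" by (simp_all add: defs)
  have sw: "swap_vars j c = c" "swap_vars j d = d" "swap_vars k a = a" "swap_vars k b = b"
    using assms by (simp_all add: defs transpose_apply_other)
  define s t where "s = swap_vars j" and "t = swap_vars k"
  have 1: "(a - b) * divdiff_bar j g = (1 - b) * g - (1 - a) * s g" for g
    unfolding defs s_def by (rule divdiff_bar_eq)
  have 2: "(c - d) * divdiff_bar k g = (1 - d) * g - (1 - c) * t g" for g
    unfolding defs t_def by (rule divdiff_bar_eq)
  have 3: "(c - d) * s (divdiff_bar k f) = (1 - d) * s f - (1 - c) * s (t f)"
    using arg_cong[OF 2[of f], of s] by (simp add: s_def swap_vars_simps sw)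
  have 4: "(a - b) * t (divdiff_bar j f) = (1 - b) * t f - (1 - a) * s (t f)"
    using arg_cong[OF 1[of f], of t]
    by (simp add: s_def t_def swap_vars_simps sw swap_vars_commute[OF assms])
  have "(c - d) * ((a - b) * divdiff_bar j (divdiff_bar k f)) =
      (1 - b) * ((c - d) * divdiff_bar k f) - (1 - a) * ((c - d) * s (divdiff_bar k f))"
    unfolding 1 by (simp add: algebra_simps)
  also have "\<dots> = (1 - d) * ((a - b) * divdiff_bar j f) -
      (1 - c) * ((a - b) * t (divdiff_bar j f))"
    unfolding 1 2 3 4 by (simp add: algebra_simps)
  also have "\<dots> = (a - b) * ((c - d) * divdiff_bar k (divdiff_bar j f))"
    unfolding 2 by (simp add: algebra_simps)
  finally have "((a - b) * (c - d)) * divdiff_bar j (divdiff_bar k f) =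
      ((a - b) * (c - d)) * divdiff_bar k (divdiff_bar j f)"
    by (simp add: algebra_simps)
  with nz show ?thesis by simp
qed

lemma divdiff_bar_braid:
  "divdiff_bar j (divdiff_bar (Suc j) (divdiff_bar j f)) =
   divdiff_bar (Suc j) (divdiff_bar j (divdiff_bar (Suc j) f))"
proof -
  define a b c where "a = X j" and "b = X (Suc j)" and "c = X (Suc (Suc j))"
  note defs = a_def b_def c_def
  define s t where "s = swap_vars j" and "t = swap_vars (Suc j)"
  define p q where "p = divdiff_bar j" and "q = divdiff_bar (Suc j)"
  have nz: "a - b \<noteq> 0" "b - c \<noteq> 0" "a - c \<noteq> 0" by (simp_all add: defs)
  have sw: "s a = b" "s b = a" "s c = c" "t a = a" "t b = c" "t c = b" "s 1 = 1" "t 1 = 1"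
    by (simp_all add: defs s_def t_def transpose_apply_other)
  have hom: "s (g - h) = s g - s h" "s (g * h) = s g * s h"
    "t (g - h) = t g - t h" "t (g * h) = t g * t h" for g h
    by (simp_all add: s_def t_def swap_vars_simps)
  have inv: "s (s g) = g" "t (t g) = g" for g by (simp_all add: s_def t_def)
  have braid: "t (s (t g)) = s (t (s g))" for g
    unfolding s_def t_def by (rule swap_vars_braid[symmetric])
  have P: "(a - b) * p g = (1 - b) * g - (1 - a) * s g" for g
    unfolding defs s_def p_def by (rule divdiff_bar_eq)
  have Q: "(b - c) * q g = (1 - c) * g - (1 - b) * t g" for g
    unfolding defs t_def q_def by (rule divdiff_bar_eq)
  have tP: "(a - c) * t (p g) = (1 - c) * t g - (1 - a) * t (s g)" for g
    using arg_cong[OF P[of g], of t] by (simp add: hom sw)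
  have sQ: "(a - c) * s (q g) = (1 - c) * s g - (1 - a) * s (t g)" for g
    using arg_cong[OF Q[of g], of s] by (simp add: hom sw)
  have stP: "(b - c) * s (t (p g)) = (1 - c) * s (t g) - (1 - b) * s (t (s g))" for g
    using arg_cong[OF tP[of g], of s] by (simp add: hom sw)
  have tsQ: "(a - b) * t (s (q g)) = (1 - b) * t (s g) - (1 - a) * s (t (s g))" for g
    using arg_cong[OF sQ[of g], of t] by (simp add: hom sw braid)
  have sP: "s (p g) = p g" for g
  proof -
    have "(b - a) * s (p g) = (1 - a) * s g - (1 - b) * g"
      using arg_cong[OF P[of g], of s] by (simp add: hom sw inv)
    with P[of g] have "(a - b) * s (p g) = (a - b) * p g" by algebra
    with nz show ?thesis by simp
  qed
  have tQ: "t (q g) = q g" for g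
  proof -
    have "(c - b) * t (q g) = (1 - b) * t g - (1 - c) * g"
      using arg_cong[OF Q[of g], of t] by (simp add: hom sw inv)
    with Q[of g] have "(b - c) * t (q g) = (b - c) * q g" by algebra
    with nz show ?thesis by simp
  qed
  define R where "R =
    (1 - b) * (1 - c) * (1 - c) * f - (1 - a) * (1 - c) * (1 - c) * s f
    - (1 - b) * (1 - b) * (1 - c) * t f + (1 - a) * (1 - a) * (1 - c) * s (t f)
    + (1 - a) * (1 - b) * (1 - b) * t (s f) - (1 - a) * (1 - a) * (1 - b) * s (t (s f))"
  have L: "(a - b) * (b - c) * (a - c) * p (q (p f)) = R"
  proof -
    have "(a - b) * ((a - b) * (b - c) * (a - c) * p (q (p f))) =
        (a - b) * (b - c) * (a - c) * ((a - b) * p (q (p f)))"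
      by (simp only: ac_simps)
    also have "\<dots> = (1 - b) * (a - b) * (a - c) * ((b - c) * q (p f)) -
        (1 - a) * (a - b) * (b - c) * ((a - c) * s (q (p f)))"
      unfolding P[of "q (p f)"] by algebra
    also have "\<dots> = ((1 - b) * (1 - c) * (a - c) - (1 - a) * (1 - c) * (b - c)) * ((a - b) * p f)
        - (1 - b) * (1 - b) * (a - b) * ((a - c) * t (p f))
        + (1 - a) * (1 - a) * (a - b) * ((b - c) * s (t (p f)))"
      unfolding Q[of "p f"] sQ[of "p f"] sP by algebra
    also have "\<dots> = (a - b) * R"
      unfolding P[of f] tP[of f] stP[of f] R_def by algebra
    finally show ?thesis using nz by simp
  qed
  have "(a - b) * (b - c) * (a - c) * q (p (q f)) = R"
  proof -
    have "(b - c) * ((a - b) * (b - c) * (a - c) * q (p (q f))) =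
        (a - b) * (b - c) * (a - c) * ((b - c) * q (p (q f)))"
      by (simp only: ac_simps)
    also have "\<dots> = (1 - c) * (b - c) * (a - c) * ((a - b) * p (q f)) -
        (1 - b) * (a - b) * (b - c) * ((a - c) * t (p (q f)))"
      unfolding Q[of "p (q f)"] by algebra
    also have "\<dots> = ((1 - c) * (1 - b) * (a - c) - (1 - b) * (1 - c) * (a - b)) * ((b - c) * q f)
        - (1 - c) * (1 - a) * (b - c) * ((a - c) * s (q f))
        + (1 - b) * (1 - a) * (b - c) * ((a - b) * t (s (q f)))"
      unfolding P[of "q f"] tP[of "q f"] tQ by algebra
    also have "\<dots> = (b - c) * R"
      unfolding Q[of f] sQ[of f] tsQ[of f] R_def by algebra
    finally show ?thesis using nz by simp
  qed
  with L have "((a - b) * (b - c) * (a - c)) * p (q (p f)) =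
      ((a - b) * (b - c) * (a - c)) * q (p (q f))"
    by simp
  with nz show ?thesis unfolding p_def q_def by simp
qed

lemma comp_transpose_permutes:
  assumes "w permutes {1..n}" "j \<in> {1..<n}"
  shows "w \<circ> transpose j (Suc j) permutes {1..n}"
  using assms by (intro permutes_compose permutes_swap_id) auto

lemma w0_permutes: "w0 n permutes {1..n}"
proof (rule bij_imp_permutes)
  show "bij_betw (w0 n) {1..n} {1..n}"
    by (rule bij_betw_byWitness[where f' = "w0 n"]) (auto simp: w0_def)
qed (auto simp: w0_def)

lemma is_grothendieck_permutes: "is_grothendieck n w f \<Longrightarrow> w permutes {1..n}"
  by (erule is_grothendieck.cases) (simp_all only: w0_permutes)

lemma permutes_eq_w0:
  assumes w: "w permutes {1..n}" and desc: "\<And>j. j \<in> {1..<n} \<Longrightarrow> w (Suc j) \<le> w j"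
  shows "w = w0 n"
proof
  have inj: "inj w" using permutes_inj[OF w] .
  have str: "w (Suc j) < w j" if "j \<in> {1..<n}" for j
    using desc[OF that] inj by (metis le_neq_implies_less injD n_not_Suc_n)
  have range: "1 \<le> w j" "w j \<le> n" if "j \<in> {1..n}" for j
    using permutes_in_image[OF w, of j] that by auto
  have upper: "j \<le> n \<Longrightarrow> w j + j \<le> n + 1" if "1 \<le> j" for j
    using that
  proof (induction j rule: dec_induct)
    case base
    then show ?case using range(2)[of 1] by simp
  next
    case (step j)
    then show ?case using str[of j] by simp
  qed
  have lower: "k < n \<Longrightarrow> k + 1 \<le> w (n - k)" for k
  proof (induction k)
    case 0
    then show ?case using range(1)[of n] by simp
  next
    case (Suc k)
    have "Suc (n - Suc k) = n - k" using Suc.prems by simp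
    moreover have "n - Suc k \<in> {1..<n}" using Suc.prems by auto
    ultimately show ?case using Suc str[of "n - Suc k"] by simp
  qed
  fix i
  show "w i = w0 n i"
  proof (cases "i \<in> {1..n}")
    case True
    then have "w i + i \<le> n + 1" and "n - i + 1 \<le> w i"
      using upper[of i] lower[of "n - i"] by auto
    with True show ?thesis by (simp add: w0_def)
  next
    case False
    then show ?thesis using permutes_not_in[OF w False] by (auto simp: w0_def)
  qed
qed

definition weighted_sum :: "nat \<Rightarrow> (nat \<Rightarrow> nat) \<Rightarrow> nat" where
  "weighted_sum n w = (\<Sum>i\<in>{1..n}. i * w i)"

lemma weighted_sum_less:
  assumes "j \<in> {1..<n}" "w j < w (Suc j)"
  shows "weighted_sum n (w \<circ> transpose j (Suc j)) < weighted_sum n w"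
proof -
  let ?A = "{1..n} - {j} - {Suc j}"
  have split: "weighted_sum n v = j * v j + (Suc j * v (Suc j) + (\<Sum>i\<in>?A. i * v i))" for v
    unfolding weighted_sum_def using assms(1)
    by (subst sum.remove[of _ j], simp, simp, subst sum.remove[of _ "Suc j"]) auto
  have "(\<Sum>i\<in>?A. i * (w \<circ> transpose j (Suc j)) i) = (\<Sum>i\<in>?A. i * w i)"
    by (rule sum.cong) (auto simp: transpose_apply_other)
  with assms(2) show ?thesis unfolding split by simp
qed

lemma is_grothendieck_exists: "w permutes {1..n} \<Longrightarrow> \<exists>f. is_grothendieck n w f"
proof (induction "weighted_sum n w" arbitrary: w rule: less_induct)
  case less
  show ?case
  proof (cases "w = w0 n")
    case True
    then show ?thesis using is_grothendieck.top by blast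
  next
    case False
    then obtain j where j: "j \<in> {1..<n}" "w j < w (Suc j)"
      using permutes_eq_w0[OF less.prems] by (meson not_le)
    obtain f where "is_grothendieck n (w \<circ> transpose j (Suc j)) f"
      using less.hyps[OF weighted_sum_less[of j n w, OF j]
          comp_transpose_permutes[OF less.prems j(1)]]
      by blast
    then show ?thesis using is_grothendieck.step[OF less.prems j] by blast
  qed
qed

lemma w0_no_ascent: "j \<in> {1..<n} \<Longrightarrow> \<not> w0 n j < w0 n (Suc j)"
  by (auto simp: w0_def)

lemma is_grothendieck_unique:
  "is_grothendieck n w f \<Longrightarrow> is_grothendieck n w g \<Longrightarrow> f = g"
proof (induction "weighted_sum n w" arbitrary: w f g rule: less_induct)
  case less
  let ?s = "\<lambda>j. transpose j (Suc j)"
  have w: "w permutes {1..n}" using is_grothendieck_permutes[OF less.prems(1)] .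
  have IH: "f' = g'" if "j \<in> {1..<n}" "w j < w (Suc j)"
    "is_grothendieck n (w \<circ> ?s j) f'" "is_grothendieck n (w \<circ> ?s j) g'" for j f' g'
    using less.hyps[OF weighted_sum_less[of j n w, OF that(1,2)] that(3,4)] .
  have far: "divdiff_bar j f' = divdiff_bar k g'"
    if j: "j \<in> {1..<n}" "w j < w (Suc j)" "is_grothendieck n (w \<circ> ?s j) f'"
      and k: "k \<in> {1..<n}" "w k < w (Suc k)" "is_grothendieck n (w \<circ> ?s k) g'"
      and jk: "Suc j < k" for j k f' g'
  proof -
    have com: "w \<circ> ?s j \<circ> ?s k = w \<circ> ?s k \<circ> ?s j"
      using jk by (auto simp: fun_eq_iff transpose_def)
    have pj: "w \<circ> ?s j permutes {1..n}" and pk: "w \<circ> ?s k permutes {1..n}"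
      using comp_transpose_permutes[OF w] j k by blast+
    obtain h where h: "is_grothendieck n (w \<circ> ?s j \<circ> ?s k) h"
      using is_grothendieck_exists comp_transpose_permutes[OF pj k(1)] by blast
    have "is_grothendieck n (w \<circ> ?s j) (divdiff_bar k h)"
      using jk k(2) by (intro is_grothendieck.step[OF pj k(1) _ h]) (simp add: transpose_def)
    moreover have "is_grothendieck n (w \<circ> ?s k) (divdiff_bar j h)"
      using jk j(2)
      by (intro is_grothendieck.step[OF pk j(1) _ h[unfolded com]]) (simp add: transpose_def)
    ultimately have "f' = divdiff_bar k h" "g' = divdiff_bar j h"
      using IH j k by blast+
    then show ?thesis using divdiff_bar_commute[OF jk] by simp
  qed
  have near: "divdiff_bar j f' = divdiff_bar k g'"
    if j: "j \<in> {1..<n}" "w j < w (Suc j)" "is_grothendieck n (w \<circ> ?s j) f'"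
      and k: "k \<in> {1..<n}" "w k < w (Suc k)" "is_grothendieck n (w \<circ> ?s k) g'"
      and jk: "k = Suc j" for j k f' g'
  proof -
    have com: "w \<circ> ?s j \<circ> ?s k \<circ> ?s j = w \<circ> ?s k \<circ> ?s j \<circ> ?s k"
      using jk by (auto simp: fun_eq_iff transpose_def)
    have pj: "w \<circ> ?s j permutes {1..n}" and pk: "w \<circ> ?s k permutes {1..n}"
      using comp_transpose_permutes[OF w] j k by blast+
    have pjk: "w \<circ> ?s j \<circ> ?s k permutes {1..n}" and pkj: "w \<circ> ?s k \<circ> ?s j permutes {1..n}"
      using comp_transpose_permutes[OF pj k(1)] comp_transpose_permutes[OF pk j(1)] .
    obtain h where h: "is_grothendieck n (w \<circ> ?s j \<circ> ?s k \<circ> ?s j) h"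
      using is_grothendieck_exists comp_transpose_permutes[OF pjk j(1)] by blast
    have "is_grothendieck n (w \<circ> ?s j \<circ> ?s k) (divdiff_bar j h)"
      using jk j k by (intro is_grothendieck.step[OF pjk j(1) _ h]) (simp add: transpose_def)
    then have "is_grothendieck n (w \<circ> ?s j) (divdiff_bar k (divdiff_bar j h))"
      using jk j k by (intro is_grothendieck.step[OF pj k(1)]) (simp_all add: transpose_def)
    moreover have "is_grothendieck n (w \<circ> ?s k \<circ> ?s j) (divdiff_bar k h)"
      using jk j k
      by (intro is_grothendieck.step[OF pkj k(1) _ h[unfolded com]]) (simp add: transpose_def)
    then have "is_grothendieck n (w \<circ> ?s k) (divdiff_bar j (divdiff_bar k h))"
      using jk j k by (intro is_grothendieck.step[OF pk j(1)]) (simp_all add: transpose_def)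
    ultimately have "f' = divdiff_bar k (divdiff_bar j h)" "g' = divdiff_bar j (divdiff_bar k h)"
      using IH j k by blast+
    then show ?thesis using divdiff_bar_braid jk by simp
  qed
  from less.prems(1) show ?case
  proof cases
    case top
    from less.prems(2) show ?thesis
    proof cases
      case top': top
      with top show ?thesis by simp
    next
      case (step j g')
      then show ?thesis using top w0_no_ascent by blast
    qed
  next
    case (step j f')
    note j = step
    from less.prems(2) show ?thesis
    proof cases
      case top
      then show ?thesis using j w0_no_ascent by blast
    next
      case (step k g')
      consider "j = k" | "Suc j < k" | "k = Suc j" | "Suc k < j" | "j = Suc k" by linarith
      then show ?thesis
      proof cases
        case 1
        then show ?thesis using IH j step by blast
      next
        case 2
        then show ?thesis using far[of j f' k g'] j step by blast
      next
        case 3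
        then show ?thesis using near[of j f' k g'] j step by blast
      next
        case 4
        then show ?thesis using far[of k g' j f'] j step by metis
      next
        case 5
        then show ?thesis using near[of k g' j f'] j step by metis
      qed
    qed
  qed
qed

lemma is_grothendieck_ex1: "w permutes {1..n} \<Longrightarrow> \<exists>!f. is_grothendieck n w f"
  using is_grothendieck_exists is_grothendieck_unique by blast

lemma grothendieck_eqI: "is_grothendieck n w f \<Longrightarrow> grothendieck n w = f"
  unfolding grothendieck_def using is_grothendieck_unique by blast

lemma is_grothendieck_grothendieck:
  "w permutes {1..n} \<Longrightarrow> is_grothendieck n w (grothendieck n w)"
  using is_grothendieck_exists grothendieck_eqI by metis

lemma grothendieck_w0: "grothendieck n (w0 n) = (\<Prod>i\<in>{1..<n}. X i ^ (n - i))"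
  by (rule grothendieck_eqI) (rule is_grothendieck.top)

lemma grothendieck_ascent:
  assumes "w permutes {1..n}" "j \<in> {1..<n}" "w j < w (Suc j)"
  shows "grothendieck n w = divdiff_bar j (grothendieck n (w \<circ> transpose j (Suc j)))"
  using assms
  by (intro grothendieck_eqI is_grothendieck.step is_grothendieck_grothendieck
      comp_transpose_permutes)

section \<open>Existence and uniqueness of the orthodontic sequence\<close>

lemma orthodontia_length: "orthodontia Cs is ms \<Longrightarrow> length is = length ms"
  by (induction rule: orthodontia.induct) auto

lemma orthodontia_unique:
  "orthodontia Cs is ms \<Longrightarrow> orthodontia Cs is' ms' \<Longrightarrow> is = is' \<and> ms = ms'"
proof (induction arbitrary: is' ms' rule: orthodontia.induct)
  case (stop Cs)
  from stop(2,1) show ?case by cases auto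
next
  case (step Cs i Ds m "is" ms)
  from step.prems show ?case
  proof cases
    case stop
    then show ?thesis using step.hyps by blast
  next
    case (step i' Ds' m' is'' ms'')
    then show ?thesis using step.IH step.hyps by blast
  qed
qed

lemma missing_tooth_exists:
  assumes "finite C" "0 \<notin> C" "\<And>j. C \<noteq> {1..j}"
  shows "\<exists>i. missing_tooth C i"
proof (rule ccontr)
  assume none: "\<nexists>i. missing_tooth C i"
  have ne: "C \<noteq> {}" using assms(3)[of 0] by auto
  have down: "i \<in> C" if "i \<le> Max C" "1 \<le> i" for i
    using that
  proof (induction i rule: inc_induct)
    case base
    then show ?case using assms(1) ne by simp
  next
    case (step i)
    then show ?case using none unfolding missing_tooth_def by auto
  qed
  have "C = {1..Max C}"
  proof
    show "C \<subseteq> {1..Max C}"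
      using assms(1,2) by (auto simp: Suc_le_eq) (metis gr0I)
  qed (use down in auto)
  then show False using assms(3) by blast
qed

definition no_standard :: "nat set list \<Rightarrow> bool" where
  "no_standard Cs \<longleftrightarrow> (\<forall>C\<in>set Cs. finite C \<and> 0 \<notin> C \<and> (\<forall>j\<ge>1. C \<noteq> {1..j}))"

lemma no_standard_step:
  assumes "no_standard Cs" "1 \<le> i"
  shows "no_standard (clear_cols {i} (swap_rows i Cs))"
  unfolding no_standard_def
proof
  fix E assume "E \<in> set (clear_cols {i} (swap_rows i Cs))"
  then have "E \<in> (\<lambda>C. if transpose i (Suc i) ` C = {1..i} then {}
      else transpose i (Suc i) ` C) ` set Cs"
    by (simp add: clear_cols_def swap_rows_def comp_def image_image)
  then obtain C where C: "C \<in> set Cs"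
    and E: "E = (if transpose i (Suc i) ` C = {1..i} then {} else transpose i (Suc i) ` C)"
    by (rule imageE)
  have C': "finite C" "0 \<notin> C" "\<And>j. 1 \<le> j \<Longrightarrow> C \<noteq> {1..j}"
    using assms C unfolding no_standard_def by auto
  show "finite E \<and> 0 \<notin> E \<and> (\<forall>j\<ge>1. E \<noteq> {1..j})"
  proof (cases "transpose i (Suc i) ` C = {1..i}")
    case True
    then show ?thesis using E by auto
  next
    case False
    then have E: "E = transpose i (Suc i) ` C" "E \<noteq> {1..i}" using E by auto
    have "E \<noteq> {1..j}" if "1 \<le> j" for j
    proof
      assume eq: "E = {1..j}"
      with E have "j \<noteq> i" by auto
      then have "transpose i (Suc i) ` {1..j} = {1..j}"
        using assms(2) by (intro transpose_image_eq) auto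
      moreover have "transpose i (Suc i) ` E = C" by (simp add: E image_image)
      ultimately show False using C'(3)[OF that] eq by simp
    qed
    moreover have "0 \<notin> E"
      using C'(2) assms(2) by (auto simp: E transpose_def split: if_splits)
    ultimately show ?thesis using C'(1) E by simp
  qed
qed

lemma orthodontia_exists: "no_standard Cs \<Longrightarrow> \<exists>is ms. orthodontia Cs is ms"
proof (induction Cs rule: wf_induct_rule[OF wf_measures[of
        "[\<lambda>Cs. length (filter (\<lambda>C. C \<noteq> {}) Cs), \<lambda>Cs. \<Sum>(leftmost Cs)]"]])
  case (1 Cs)
  show ?case
  proof (cases "\<forall>C\<in>set Cs. C = {}")
    case True
    then show ?thesis using orthodontia.stop by blast
  next
    case False
    then have "\<exists>As C Bs. Cs = As @ C # Bs \<and> C \<noteq> {} \<and> (\<forall>A\<in>set As. \<not> A \<noteq> {})"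
      by (intro split_list_first_prop) simp
    then obtain As C Bs where Cs: "Cs = As @ C # Bs" and C: "C \<noteq> {}"
      and As: "\<forall>A\<in>set As. A = {}"
      unfolding not_not by (elim exE conjE)
    have As': "filter (\<lambda>C. C \<noteq> {}) As = []" using As by (auto simp: filter_empty_conv)
    have left: "leftmost Cs = C" using As' C by (simp add: leftmost_def Cs)
    have C': "finite C" "0 \<notin> C" "\<And>j. 1 \<le> j \<Longrightarrow> C \<noteq> {1..j}"
      using 1(2) unfolding no_standard_def Cs by auto
    have "C \<noteq> {1..j}" for j using C C'(3)[of j] by (cases j) auto
    then have "\<exists>i. missing_tooth C i" using missing_tooth_exists C' by blast
    then have tooth: "missing_tooth C (LEAST i. missing_tooth C i)" by (rule LeastI_ex)
    define i where "i = (LEAST i. missing_tooth (leftmost Cs) i)"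
    have i: "1 \<le> i" "i \<notin> C" "Suc i \<in> C"
      using tooth unfolding i_def left missing_tooth_def by auto
    let ?t = "\<lambda>C. transpose i (Suc i) ` C"
    define D where "D = ?t C"
    have D: "D = insert i (C - {Suc i})"
      unfolding D_def using i by (auto simp: transpose_def image_iff)
    have sum: "\<Sum>D < \<Sum>C"
      using i C'(1) by (simp add: D sum.remove[of C "Suc i"])
    define g where "g = (\<lambda>C. if ?t C = {1..i} then {} else ?t C)"
    define Es where "Es = clear_cols {i} (swap_rows i Cs)"
    have Es: "Es = map g Cs" by (simp add: Es_def clear_cols_def swap_rows_def g_def)
    have le: "length (filter (\<lambda>C. C \<noteq> {}) (map g Ls)) \<le> length (filter (\<lambda>C. C \<noteq> {}) Ls)" for Ls
      by (induction Ls) (auto simp: g_def)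
    have gAs: "filter (\<lambda>C. C \<noteq> {}) (map g As) = []"
      using As by (auto simp: filter_empty_conv g_def)
    have "(Es, Cs) \<in> measures
        [\<lambda>Cs. length (filter (\<lambda>C. C \<noteq> {}) Cs), \<lambda>Cs. \<Sum>(leftmost Cs)]"
    proof (cases "D = {1..i}")
      case True
      then have "g C = {}" by (simp add: g_def D_def)
      then have "length (filter (\<lambda>C. C \<noteq> {}) Es) < length (filter (\<lambda>C. C \<noteq> {}) Cs)"
        using le[of Bs] C gAs by (simp add: Es Cs less_Suc_eq_le)
      then show ?thesis by simp
    next
      case False
      then have gC: "g C = D" by (simp add: g_def D_def)
      have "D \<noteq> {}" by (simp add: D)
      then have "leftmost Es = D" using gAs gC by (simp add: leftmost_def Es Cs)
      moreover have "length (filter (\<lambda>C. C \<noteq> {}) Es) \<le> length (filter (\<lambda>C. C \<noteq> {}) Cs)"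
        unfolding Es by (rule le)
      ultimately show ?thesis using sum left by auto
    qed
    moreover have "no_standard Es" unfolding Es_def using no_standard_step[OF 1(2) i(1)] .
    ultimately obtain "is" ms where "orthodontia Es is ms" using 1(1) by blast
    then have "orthodontia Cs (i # is) (count_list (swap_rows i Cs) {1..i} # ms)"
      using False unfolding Es_def by (intro orthodontia.step[OF _ i_def refl refl]) auto
    then show ?thesis by blast
  qed
qed

lemma orthodontic_sequence_exists: "\<exists>is ks ms. orthodontic_sequence n w is ks ms"
proof -
  have "no_standard (clear_cols {1..n} (columns n (rothe n w)))"
    unfolding no_standard_def
  proof
    fix E assume "E \<in> set (clear_cols {1..n} (columns n (rothe n w)))"
    then obtain C where C: "C \<in> set (columns n (rothe n w))"
      and E: "E = (if \<exists>j\<in>{1..n}. C = {1..j} then {} else C)"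
      by (auto simp: clear_cols_def)
    have sub: "C \<subseteq> {1..n}" using C by (auto simp: columns_def rothe_def)
    have "C \<noteq> {1..j}" if "\<not> (\<exists>j\<in>{1..n}. C = {1..j})" "1 \<le> j" for j
    proof
      assume "C = {1..j}"
      with sub that(2) have "j \<in> {1..n}" by auto
      with that(1) \<open>C = {1..j}\<close> show False by blast
    qed
    then show "finite E \<and> 0 \<notin> E \<and> (\<forall>j\<ge>1. E \<noteq> {1..j})"
      using sub finite_subset[OF sub] by (auto simp: E)
  qed
  then show ?thesis unfolding orthodontic_sequence_def using orthodontia_exists by blast
qed

lemma orthodontic_sequence_unique:
  assumes "orthodontic_sequence n w is ks ms" "orthodontic_sequence n w is' ks' ms'"
  shows "is = is' \<and> ks = ks' \<and> ms = ms'"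
  using assms orthodontia_unique unfolding orthodontic_sequence_def by blast

end

theory Submission
  imports Defs
begin

text \<open>
  Let row \<open>i\<close> of a diagram be contained in row \<open>i + 1\<close>. Swapping these two rows should then
  correspond to applying \<open>demazure_bar i\<close>. This holds for all diagrams in which, for every column
  \<open>C\<close> left of a column \<open>C'\<close>, the elements of \<open>C - C'\<close> precede those of \<open>C' - C\<close>: in such
  a diagram every missing tooth of the first column allows a swap, swaps preserve the condition,
  and the braid relations make the resulting polynomial independent of the order of the swaps.

  Rothe diagrams satisfy the condition. If \<open>w \<noteq> w0\<close>, let \<open>k\<close> be the smallest value that is not at
  its position in \<open>w0\<close>, and \<open>p\<close> its position in \<open>w\<close>. Then \<open>p\<close> is an ascent, the first \<open>k\<close>
  columns of the diagram are standard, and the later ones have an empty row \<open>p\<close>. Replacing \<open>w\<close> by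
  \<open>w \<circ> transpose p (Suc p)\<close> adds the box \<open>p\<close> to column \<open>k\<close> and swaps the rows \<open>p\<close> and \<open>p + 1\<close>
  of the later columns, so the defining recursion of Grothendieck polynomials becomes an
  application of \<open>demazure_bar p\<close> to those columns.
\<close>

section \<open>Demazure operators\<close>

lemma divdiff_bar_diff: "divdiff_bar j (f - g) = divdiff_bar j f - divdiff_bar j g"
proof -
  have "(X j - X (Suc j)) * divdiff_bar j (f - g) =
      (X j - X (Suc j)) * (divdiff_bar j f - divdiff_bar j g)"
    unfolding right_diff_distrib[of "X j - X (Suc j)"] divdiff_bar_eq
    by (simp add: swap_vars_diff algebra_simps)
  then show ?thesis by simp
qed

lemma divdiff_bar_mult_symmetric:
  assumes "swap_vars j g = g"
  shows "divdiff_bar j (g * f) = g * divdiff_bar j f"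
proof -
  have "(X j - X (Suc j)) * divdiff_bar j (g * f) =
      g * ((X j - X (Suc j)) * divdiff_bar j f)"
    unfolding divdiff_bar_eq by (simp add: swap_vars_mult assms algebra_simps)
  also have "\<dots> = (X j - X (Suc j)) * (g * divdiff_bar j f)"
    by (rule mult.left_commute)
  finally show ?thesis by simp
qed

lemma swap_vars_divdiff_bar: "swap_vars j (divdiff_bar j f) = divdiff_bar j f"
proof -
  have "swap_vars j ((X j - X (Suc j)) * divdiff_bar j f) =
      swap_vars j ((1 - X (Suc j)) * f - (1 - X j) * swap_vars j f)"
    by (simp only: divdiff_bar_eq)
  then have "(X (Suc j) - X j) * swap_vars j (divdiff_bar j f) =
      (1 - X j) * swap_vars j f - (1 - X (Suc j)) * f"
    by (simp add: swap_vars_simps)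
  then have "(X j - X (Suc j)) * swap_vars j (divdiff_bar j f) =
      (X j - X (Suc j)) * divdiff_bar j f"
    unfolding divdiff_bar_eq by algebra
  then show ?thesis by simp
qed

text \<open>The twisted Leibniz rule for the factor \<open>X j\<close>: moving it out turns it into
  \<open>X (Suc j)\<close>, at the cost of a correction term.\<close>

lemma divdiff_bar_X_mult:
  "divdiff_bar j (X j * f) = X (Suc j) * divdiff_bar j f + (1 - X (Suc j)) * f"
proof -
  have "(X j - X (Suc j)) * divdiff_bar j (X j * f) =
      X (Suc j) * ((X j - X (Suc j)) * divdiff_bar j f) +
      (X j - X (Suc j)) * ((1 - X (Suc j)) * f)"
    unfolding divdiff_bar_eq by (simp add: swap_vars_mult) algebra
  also have "\<dots> = (X j - X (Suc j)) * (X (Suc j) * divdiff_bar j f + (1 - X (Suc j)) * f)"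
    by algebra
  finally show ?thesis by simp
qed

text \<open>Together with the factor built into \<open>divdiff_bar j\<close>, the argument becomes
  \<open>(1 - X (Suc j)) * (1 - X j) * g\<close>, which is symmetric. In the braid relation this
  kills the correction term of the Leibniz rule.\<close>

lemma divdiff_bar_one_minus_X_mult_symmetric:
  assumes "swap_vars j g = g"
  shows "divdiff_bar j ((1 - X j) * g) = 0"
proof -
  have "(X j - X (Suc j)) * divdiff_bar j ((1 - X j) * g) = 0"
    unfolding divdiff_bar_eq by (simp add: swap_vars_simps assms algebra_simps)
  then show ?thesis by simp
qed

lemma demazure_bar_eq_divdiff_bar: "demazure_bar j f = divdiff_bar j (X j * f)"
  by (simp add: demazure_bar_def divdiff_bar_def mult_ac)

lemma demazure_bar_mult_symmetric:
  "swap_vars j g = g \<Longrightarrow> demazure_bar j (g * f) = g * demazure_bar j f"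
  by (simp add: demazure_bar_eq_divdiff_bar mult.left_commute[of "X j"]
      divdiff_bar_mult_symmetric)

lemma demazure_bar_1: "demazure_bar j 1 = 1"
  unfolding demazure_bar_def by (rule divdiff_unique) (simp add: swap_vars_simps algebra_simps)

lemma demazure_bar_commute:
  assumes "Suc j < k"
  shows "demazure_bar j (demazure_bar k f) = demazure_bar k (demazure_bar j f)"
proof -
  have "swap_vars j (X k) = X k" "swap_vars k (X j) = X j"
    using assms by (simp_all add: transpose_apply_other)
  then show ?thesis
    unfolding demazure_bar_eq_divdiff_bar
    by (simp add: divdiff_bar_mult_symmetric[symmetric] divdiff_bar_commute[OF assms]
        mult.left_commute)
qed

text \<open>Reduced to \<open>divdiff_bar_braid\<close> by moving variables through operators:
  \<open>X j\<close> is invariant under the swap for \<open>Suc j\<close>, and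
  \<open>X j * X (Suc j)\<close> under the swap for \<open>j\<close>.\<close>

lemma demazure_bar_braid:
  "demazure_bar j (demazure_bar (Suc j) (demazure_bar j f)) =
   demazure_bar (Suc j) (demazure_bar j (demazure_bar (Suc j) f))"
proof -
  define p q where "p = divdiff_bar j" and "q = divdiff_bar (Suc j)"
  define a b where "a = X j" and "b = X (Suc j)"
  have q_a: "q (a * g) = a * q g" for g
    unfolding q_def a_def
    by (intro divdiff_bar_mult_symmetric) (simp add: transpose_apply_other)
  have p_ab: "p (a * (b * g)) = a * (b * p g)" for g
    using divdiff_bar_mult_symmetric[of j "a * b" g]
    by (simp add: p_def a_def b_def swap_vars_mult mult_ac)
  have b_p: "b * p g = p (a * g) - (1 - b) * g" for g
    by (simp add: p_def a_def b_def divdiff_bar_X_mult)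
  have q_diff: "q (g - h) = q g - q h" for g h
    by (simp add: q_def divdiff_bar_diff)
  have q_0: "q ((1 - b) * q g) = 0" for g
    unfolding q_def b_def
    by (intro divdiff_bar_one_minus_X_mult_symmetric swap_vars_divdiff_bar)
  have "p (a * q (b * p (a * f))) = p (q (p (a * (b * (a * f)))))"
    by (simp add: q_a p_ab)
  also have "\<dots> = q (p (q (a * (b * (a * f)))))"
    unfolding p_def q_def by (rule divdiff_bar_braid)
  also have "\<dots> = q (p (a * q (a * (b * f))))"
    by (simp add: mult_ac flip: q_a)
  \<comment> \<open>With \<open>g = q (a * (b * f))\<close>, \<open>b_p\<close> replaces
    \<open>p (a * g)\<close> by \<open>b * p g + (1 - b) * g\<close>, and \<open>q\<close>
    annihilates the second summand because \<open>g\<close> is itself a value of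
    \<open>q\<close>.\<close>
  also have "\<dots> = q (b * p (q (a * (b * f))))"
    by (simp add: b_p q_diff q_0)
  also have "\<dots> = q (b * p (a * q (b * f)))"
    by (simp add: q_a)
  finally show ?thesis
    by (simp add: demazure_bar_eq_divdiff_bar p_def q_def a_def b_def)
qed

text \<open>The transposition maps \<open>{1..j}\<close> to itself unless it crosses the upper end.
  This is what lets \<open>fund_weight j\<close> pass through \<open>demazure_bar i\<close>.\<close>

lemma swap_vars_fund_weight:
  assumes "i \<noteq> j" "1 \<le> i"
  shows "swap_vars i (fund_weight j) = fund_weight j"
proof -
  have prod: "swap_vars i (\<Prod>x\<in>A. X x) = (\<Prod>x\<in>A. X (transpose i (Suc i) x))" if "finite A" for A
    using that by (induction A rule: finite_induct) (simp_all add: swap_vars_mult)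
  have "(\<Prod>x=1..j. X (transpose i (Suc i) x)) = (\<Prod>x=1..j. X x)"
    using assms
    by (intro prod.reindex_bij_witness[of _ "transpose i (Suc i)" "transpose i (Suc i)"])
      (auto simp: transpose_def)
  then show ?thesis by (simp add: fund_weight_def prod)
qed

lemma fund_weight_Suc: "fund_weight (Suc j) = fund_weight j * X (Suc j)"
  by (simp add: fund_weight_def)

lemma fund_weight_0 [simp]: "fund_weight 0 = 1"
  by (simp add: fund_weight_def)

section \<open>Separated column families\<close>

lemma mem_transpose_image [simp]:
  "x \<in> transpose i j ` C \<longleftrightarrow> transpose i j x \<in> C"
  by (metis (no_types, lifting) image_iff transpose_involutory)

text \<open>These are the percentage-avoiding diagrams: boxes at \<open>(i2, j1)\<close> and
  \<open>(i1, j2)\<close> with \<open>i1 < i2\<close> and \<open>j1 < j2\<close> force a box at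
  \<open>(i1, j1)\<close> or \<open>(i2, j2)\<close>. Rows are numbered from 1, hence
  \<open>0 \<notin> C\<close>.\<close>

definition separated :: "nat set list \<Rightarrow> bool" where
  "separated Cs \<longleftrightarrow> (\<forall>C\<in>set Cs. finite C \<and> 0 \<notin> C) \<and>
    sorted_wrt (\<lambda>C C'. \<forall>x\<in>C - C'. \<forall>y\<in>C' - C. x < y) Cs"

definition row_subset :: "nat \<Rightarrow> nat set list \<Rightarrow> bool" where
  "row_subset i Cs \<longleftrightarrow> (\<forall>C\<in>set Cs. i \<in> C \<longrightarrow> Suc i \<in> C)"

lemma row_subset_Cons [simp]:
  "row_subset i (C # Cs) \<longleftrightarrow> (i \<in> C \<longrightarrow> Suc i \<in> C) \<and> row_subset i Cs"
  by (simp add: row_subset_def)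

lemma separated_Cons:
  "separated (C # Cs) \<longleftrightarrow> finite C \<and> 0 \<notin> C \<and>
    (\<forall>C'\<in>set Cs. \<forall>x\<in>C - C'. \<forall>y\<in>C' - C. x < y) \<and> separated Cs"
  by (auto simp: separated_def)

text \<open>A later column containing \<open>a\<close> but not \<open>Suc a\<close> would have
  \<open>a\<close> as an extra element where the first column has \<open>Suc a\<close>, the wrong
  order for separation.\<close>

lemma row_subset_head:
  assumes "separated (C # Cs)" "missing_tooth C a"
  shows "row_subset a (C # Cs)"
proof -
  have "Suc a \<in> C'" if "C' \<in> set Cs" "a \<in> C'" for C'
  proof (rule ccontr)
    assume "Suc a \<notin> C'"
    then have "Suc a < a"
      using assms that by (auto simp: separated_Cons missing_tooth_def)
    then show False by simp
  qed
  then show ?thesis using assms(2) by (auto simp: row_subset_def missing_tooth_def)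
qed

text \<open>The swap reverses the order of no pair except \<open>i < Suc i\<close>. That pair would
  need \<open>i \<in> C\<close> and \<open>Suc i \<notin> C\<close> in the left column, which
  \<open>row_subset\<close> excludes.\<close>

lemma separated_swap_rows:
  assumes "separated Cs" "row_subset i Cs" "1 \<le> i"
  shows "separated (swap_rows i Cs)"
  using assms
proof (induction Cs)
  case Nil
  then show ?case by (simp add: swap_rows_def)
next
  case (Cons C Cs)
  let ?t = "transpose i (Suc i)"
  have "x < y" if C': "C' \<in> set Cs" and x: "?t x \<in> C" "?t x \<notin> C'" and y: "?t y \<in> C'" "?t y \<notin> C"
    for C' x y
  proof -
    have "?t x < ?t y" using Cons.prems C' x y by (auto simp: separated_Cons)
    moreover have "i \<in> C \<longrightarrow> Suc i \<in> C" using Cons.prems by simp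
    ultimately show ?thesis
      using x y by (auto simp: transpose_def split: if_splits)
  qed
  then show ?case
    using Cons by (auto simp: separated_Cons swap_rows_def)
qed

lemma separated_clear:
  "separated (As @ C # Bs) \<Longrightarrow> separated (As @ {} # Bs)"
  by (auto simp: separated_def sorted_wrt_append)

section \<open>Commutation and braid relations of row swaps\<close>

lemma swap_rows_commute:
  assumes "Suc i < j"
  shows "swap_rows i (swap_rows j Cs) = swap_rows j (swap_rows i Cs)"
proof -
  have "transpose i (Suc i) \<circ> transpose j (Suc j) = transpose j (Suc j) \<circ> transpose i (Suc i)"
    using assms by (auto simp: fun_eq_iff transpose_def)
  then show ?thesis by (simp add: swap_rows_def image_comp comp_def[of "image _" "image _"])
qed

lemma swap_rows_braid:
  "swap_rows i (swap_rows (Suc i) (swap_rows i Cs)) =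
   swap_rows (Suc i) (swap_rows i (swap_rows (Suc i) Cs))"
proof -
  let ?s = "transpose i (Suc i)" and ?t = "transpose (Suc i) (Suc (Suc i))"
  have "?s \<circ> (?t \<circ> ?s) = ?t \<circ> (?s \<circ> ?t)"
    by (auto simp: fun_eq_iff transpose_def)
  then have "?s ` ?t ` ?s ` C = ?t ` ?s ` ?t ` C" for C by (simp only: image_comp)
  then show ?thesis by (simp add: swap_rows_def)
qed

lemma length_swap_rows [simp]: "length (swap_rows i Cs) = length Cs"
  by (simp add: swap_rows_def)

lemma swap_rows_Cons [simp]:
  "swap_rows i (C # Cs) = transpose i (Suc i) ` C # swap_rows i Cs"
  by (simp add: swap_rows_def)

lemma swap_rows_append [simp]: "swap_rows i (As @ Bs) = swap_rows i As @ swap_rows i Bs"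
  by (simp add: swap_rows_def)

lemma ball_set_swap_rows:
  "(\<forall>C\<in>set (swap_rows i Cs). P C) \<longleftrightarrow> (\<forall>C\<in>set Cs. P (transpose i (Suc i) ` C))"
  by (simp add: swap_rows_def)

section \<open>Row sums as a measure for inductions on swaps\<close>

lemma transpose_image_fixed:
  assumes "i \<in> C \<longleftrightarrow> Suc i \<in> C"
  shows "transpose i (Suc i) ` C = C"
  by (rule set_eqI) (use assms in \<open>auto simp: transpose_def\<close>)

lemma sum_transpose_image_less:
  assumes "finite C" "i \<notin> C" "Suc i \<in> C"
  shows "\<Sum>(transpose i (Suc i) ` C) < \<Sum>C"
proof -
  have "transpose i (Suc i) ` C = insert i (C - {Suc i})"
    using assms by (auto simp: transpose_def image_iff)
  then show ?thesis using assms by (simp add: sum.remove[of C "Suc i"])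
qed

lemma sum_transpose_image_le:
  assumes "finite C" "i \<in> C \<longrightarrow> Suc i \<in> C"
  shows "\<Sum>(transpose i (Suc i) ` C) \<le> \<Sum>C"
proof (cases "i \<in> C \<longleftrightarrow> Suc i \<in> C")
  case True
  then show ?thesis by (simp add: transpose_image_fixed)
next
  case False
  then show ?thesis using sum_transpose_image_less[of C i] assms by auto
qed

text \<open>Each box that moves up one row lowers this number by one; it is the second component of
  the measure in \<open>orth_poly_swap_rows\<close>.\<close>

definition box_sum :: "nat set list \<Rightarrow> nat" where
  "box_sum Cs = (\<Sum>C\<leftarrow>Cs. \<Sum>C)"

lemma box_sum_swap_rows_le:
  "separated Cs \<Longrightarrow> row_subset i Cs \<Longrightarrow> box_sum (swap_rows i Cs) \<le> box_sum Cs"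
  by (induction Cs)
    (auto simp: box_sum_def separated_Cons swap_rows_def intro!: add_mono sum_transpose_image_le)

lemma box_sum_swap_rows_less:
  assumes "separated (C # Cs)" "missing_tooth C a"
  shows "box_sum (swap_rows a (C # Cs)) < box_sum (C # Cs)"
proof -
  have "row_subset a Cs" using row_subset_head[OF assms] by simp
  then have "box_sum (swap_rows a Cs) \<le> box_sum Cs"
    using assms(1) by (intro box_sum_swap_rows_le) (simp_all add: separated_Cons)
  moreover have "\<Sum>(transpose a (Suc a) ` C) < \<Sum>C"
    using assms by (intro sum_transpose_image_less) (auto simp: separated_Cons missing_tooth_def)
  ultimately show ?thesis by (simp add: box_sum_def)
qed

section \<open>The polynomial of a column family\<close>

text \<open>
  Unlike the orthodontic sequence, this recursion touches a standard column only when it is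
  the first one left.
\<close>

function orth_poly :: "nat set list \<Rightarrow> cpoly" where
  "orth_poly [] = 1"
| "orth_poly (C # Cs) =
    (if finite C \<and> (\<exists>a. missing_tooth C a)
     then demazure_bar (LEAST a. missing_tooth C a)
       (orth_poly (swap_rows (LEAST a. missing_tooth C a) (C # Cs)))
     else fund_weight (card C) * orth_poly Cs)"
  by pat_completeness auto
termination
\<comment> \<open>A swap at a missing tooth keeps the number of columns and lowers the row sum of
  the first; otherwise the first column is dropped.\<close>
proof (relation "measures [length, \<lambda>Cs. \<Sum>(hd Cs)]")
  fix C :: "nat set" and Cs :: "nat set list"
  assume C: "finite C \<and> (\<exists>a. missing_tooth C a)"
  then have "missing_tooth C (LEAST a. missing_tooth C a)"
    using LeastI_ex[of "missing_tooth C"] by blast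
  then show "(swap_rows (LEAST a. missing_tooth C a) (C # Cs), C # Cs)
      \<in> measures [length, \<lambda>Cs. \<Sum>(hd Cs)]"
    using C by (simp add: sum_transpose_image_less missing_tooth_def)
qed simp_all

declare orth_poly.simps(2) [simp del]

section \<open>Unfolding at the first column and its least missing tooth\<close>

lemma no_missing_tooth_standard: "\<not> missing_tooth {1..j} a"
  by (auto simp: missing_tooth_def)

lemma orth_poly_standard: "orth_poly ({1..j} # Cs) = fund_weight j * orth_poly Cs"
proof -
  have "\<not> (finite {1..j} \<and> (\<exists>a. missing_tooth {1..j} a))"
    using no_missing_tooth_standard by blast
  then show ?thesis
    by (simp only: orth_poly.simps(2) if_False card_atLeastAtMost diff_Suc_1)
qed

lemma orth_poly_empty [simp]: "orth_poly ({} # Cs) = orth_poly Cs"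
  using orth_poly_standard[of 0 Cs] by simp

lemma orth_poly_tooth:
  assumes "finite C" "missing_tooth C a" "\<And>b. b < a \<Longrightarrow> \<not> missing_tooth C b"
  shows "orth_poly (C # Cs) = demazure_bar a (orth_poly (swap_rows a (C # Cs)))"
proof -
  have "(LEAST a. missing_tooth C a) = a"
    using assms(2,3) by (metis Least_equality not_le)
  moreover have "finite C \<and> (\<exists>a. missing_tooth C a)" using assms(1,2) by blast
  ultimately show ?thesis by (simp only: orth_poly.simps(2) simp_thms if_True)
qed

lemma standard_or_least_tooth:
  assumes "finite C" "0 \<notin> C"
  obtains (standard) j where "C = {1..j}"
  | (tooth) a where "missing_tooth C a" "\<And>b. b < a \<Longrightarrow> \<not> missing_tooth C b"
proof (cases "\<exists>a. missing_tooth C a")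
  case True
  then show thesis
    using tooth[of "LEAST a. missing_tooth C a"] LeastI_ex[OF True] not_less_Least by blast
next
  case False
  then show thesis using missing_tooth_exists[OF assms] standard by blast
qed

text \<open>For \<open>i < a\<close>, \<open>i\<close> is no tooth, so \<open>C\<close> is
  unchanged. For \<open>i = Suc a\<close>, rows \<open>i\<close> and \<open>Suc i\<close> both lie
  in \<open>C\<close>, which is again unchanged. For larger \<open>i\<close>, rows up to
  \<open>Suc a\<close> are not moved.\<close>

lemma least_tooth_transpose_image:
  assumes "missing_tooth C a" "\<And>b. b < a \<Longrightarrow> \<not> missing_tooth C b"
    and "i \<in> C \<longrightarrow> Suc i \<in> C" "i \<noteq> a" "1 \<le> i"
  shows "missing_tooth (transpose i (Suc i) ` C) a"
    and "\<And>b. b < a \<Longrightarrow> \<not> missing_tooth (transpose i (Suc i) ` C) b"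
proof -
  have *: "missing_tooth (transpose i (Suc i) ` C) a \<and>
    (\<forall>b<a. \<not> missing_tooth (transpose i (Suc i) ` C) b)"
  proof (cases "i < a")
    case True
    then have "i \<in> C \<longleftrightarrow> Suc i \<in> C"
      using assms(2)[of i] assms(3,5) by (auto simp: missing_tooth_def)
    then show ?thesis using assms by (simp add: transpose_image_fixed)
  next
    case False
    then show ?thesis
      using assms by (auto simp: missing_tooth_def transpose_def)
  qed
  then show "missing_tooth (transpose i (Suc i) ` C) a"
    and "\<And>b. b < a \<Longrightarrow> \<not> missing_tooth (transpose i (Suc i) ` C) b" by auto
qed

text \<open>
  The order in which rows are swapped does not matter: two available swaps close up to a
  commutation square or a braid hexagon, and the operators satisfy the same relations.
\<close>

theorem orth_poly_swap_rows:
  assumes "separated Cs" "row_subset i Cs" "1 \<le> i"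
  shows "orth_poly Cs = demazure_bar i (orth_poly (swap_rows i Cs))"
  using assms
proof (induction Cs arbitrary: i rule: wf_induct_rule[OF wf_measures[of "[length, box_sum]"]])
  case (1 Ds)
  show ?case
  proof (cases Ds)
    case Nil
    then show ?thesis by (simp add: swap_rows_def demazure_bar_1)
  next
    case (Cons C Cs)
    have IH: "orth_poly Es = demazure_bar j (orth_poly (swap_rows j Es))"
      if "length Es = length Ds" "box_sum Es < box_sum Ds" "separated Es" "row_subset j Es" "1 \<le> j"
      for Es j
      using that by (intro "1.IH") auto
    have sep: "separated Ds" and sub: "row_subset i Ds" and i: "1 \<le> i"
      using "1.prems" by auto
    have C: "finite C" "0 \<notin> C" and C_sub: "i \<in> C \<longrightarrow> Suc i \<in> C"
      using sep sub by (auto simp: Cons separated_Cons)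
    from C show ?thesis
    proof (cases rule: standard_or_least_tooth)
      case (standard j)
      \<comment> \<open>For \<open>i = j\<close> the interval would contain \<open>i\<close> but not
        \<open>Suc i\<close>. Hence both the column and its weight are invariant under the swap at
        \<open>i\<close>.\<close>
      then have "i \<noteq> j" using C_sub i by auto
      then have fixed: "transpose i (Suc i) ` {1..j} = {1..j}"
        using i by (intro transpose_image_fixed) auto
      have "orth_poly Cs = demazure_bar i (orth_poly (swap_rows i Cs))"
        using "1.prems" by (intro "1.IH") (auto simp: Cons separated_Cons)
      then show ?thesis
        using demazure_bar_mult_symmetric[OF swap_vars_fund_weight[OF \<open>i \<noteq> j\<close> i]]
        by (simp only: Cons standard swap_rows_Cons fixed orth_poly_standard)
    next
      case (tooth a)
      have a: "1 \<le> a" using tooth(1) by (simp add: missing_tooth_def)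
      have sub_a: "row_subset a Ds"
        using row_subset_head sep tooth(1) by (simp add: Cons)
      have sep_a: "separated (swap_rows a Ds)" and sep_i: "separated (swap_rows i Ds)"
        using separated_swap_rows sep sub sub_a i a by blast+
      have less_a: "box_sum (swap_rows a Ds) < box_sum Ds"
        using box_sum_swap_rows_less sep tooth(1) by (simp add: Cons)
      have unfold: "orth_poly Ds = demazure_bar a (orth_poly (swap_rows a Ds))"
        using orth_poly_tooth C(1) tooth by (simp add: Cons)
      show ?thesis
      proof (cases "i = a")
        case True
        then show ?thesis using unfold by simp
      next
        case False
        note tooth' = least_tooth_transpose_image[OF tooth C_sub False i]
        \<comment> \<open>The induction hypothesis may fail to apply here, since
          \<open>box_sum\<close> stays the same when rows \<open>i\<close> and \<open>Suc i\<close>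
          agree. As \<open>a\<close> is still the least tooth of the first column, the defining
          equation serves instead.\<close>
        have unfold': "orth_poly (swap_rows i Ds) =
            demazure_bar a (orth_poly (swap_rows a (swap_rows i Ds)))"
          using orth_poly_tooth[OF _ tooth', of "swap_rows i Cs"] C(1) by (simp add: Cons)
        have less_ia: "box_sum (swap_rows a (swap_rows i Ds)) < box_sum Ds"
          using box_sum_swap_rows_less[OF sep_i[unfolded Cons swap_rows_Cons] tooth'(1)]
            box_sum_swap_rows_le[OF sep sub] by (simp add: Cons)
        have sep_ia: "separated (swap_rows a (swap_rows i Ds))"
          using sep_i row_subset_head[OF sep_i[unfolded Cons swap_rows_Cons] tooth'(1)] a
          by (intro separated_swap_rows[of _ a]) (simp_all add: Cons)
        show ?thesis
        proof (cases "Suc i < a \<or> Suc a < i")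
          case True
          then have fixed: "transpose a (Suc a) i = i" "transpose a (Suc a) (Suc i) = Suc i"
            by (auto simp: transpose_def)
          have comm: "swap_rows a (swap_rows i Ds) = swap_rows i (swap_rows a Ds)"
            "demazure_bar a (demazure_bar i f) = demazure_bar i (demazure_bar a f)" for f
            using True swap_rows_commute demazure_bar_commute by metis+
          have "orth_poly (swap_rows a Ds) =
              demazure_bar i (orth_poly (swap_rows i (swap_rows a Ds)))"
            using sub i sep_a less_a
            by (intro IH) (simp_all add: row_subset_def ball_set_swap_rows fixed)
          then show ?thesis by (simp add: unfold unfold' comm)
        next
          case False
          with \<open>i \<noteq> a\<close> have adj: "Suc i = a \<or> Suc a = i" by linarith
          have rows: "swap_rows a (swap_rows i (swap_rows a Ds)) =
              swap_rows i (swap_rows a (swap_rows i Ds))"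
            and ops: "demazure_bar a (demazure_bar i (demazure_bar a f)) =
              demazure_bar i (demazure_bar a (demazure_bar i f))" for f
            using adj swap_rows_braid demazure_bar_braid by metis+
          \<comment> \<open>The three rows involved form a chain under inclusion. Along either side
            of the hexagon each swap exchanges a pair of them not exchanged before, so the smaller
            row is still the upper one.\<close>
          have sub1: "row_subset i (swap_rows a Ds)"
            and sub2: "row_subset a (swap_rows i (swap_rows a Ds))"
            and sub3: "row_subset i (swap_rows a (swap_rows i Ds))"
            using adj sub sub_a
            unfolding row_subset_def ball_set_swap_rows mem_transpose_image
            by (safe; simp add: transpose_def)+
          have "orth_poly (swap_rows a Ds) =
              demazure_bar i (orth_poly (swap_rows i (swap_rows a Ds)))"
            using sub1 sep_a less_a i by (intro IH) simp_all
          also have "orth_poly (swap_rows i (swap_rows a Ds)) =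
              demazure_bar a (orth_poly (swap_rows a (swap_rows i (swap_rows a Ds))))"
            using separated_swap_rows[OF sep_a sub1 i] sub2 less_a a
              box_sum_swap_rows_le[OF sep_a sub1]
            by (intro IH) simp_all
          finally have 1: "orth_poly Ds = demazure_bar a (demazure_bar i (demazure_bar a
              (orth_poly (swap_rows a (swap_rows i (swap_rows a Ds))))))"
            using unfold by simp
          have "orth_poly (swap_rows a (swap_rows i Ds)) =
              demazure_bar i (orth_poly (swap_rows i (swap_rows a (swap_rows i Ds))))"
            using sub3 less_ia sep_ia i by (intro IH) simp_all
          then show ?thesis using 1 unfold' by (simp add: rows ops)
        qed
      qed
    qed
  qed
qed

text \<open>Swaps caused by teeth \<open>a\<close> of earlier columns satisfy
  \<open>row_subset\<close>, so \<open>a \<noteq> j\<close>. They therefore fix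
  \<open>{1..j}\<close>, and their operators commute with multiplication by
  \<open>fund_weight j\<close>.\<close>

lemma orth_poly_remove_standard:
  "separated (As @ {1..j} # Bs) \<Longrightarrow>
    orth_poly (As @ {1..j} # Bs) = fund_weight j * orth_poly (As @ {} # Bs)"
proof (induction As arbitrary: Bs rule: wf_induct_rule[OF wf_measures[of "[length, \<lambda>As. \<Sum>(hd As)]"]])
  case (1 Ds)
  show ?case
  proof (cases Ds)
    case Nil
    then show ?thesis by (simp only: append_Nil orth_poly_standard orth_poly_empty)
  next
    case (Cons C As)
    have sep: "separated (C # As @ {1..j} # Bs)" using "1.prems" by (simp add: Cons)
    then have C: "finite C" "0 \<notin> C" by (simp_all add: separated_Cons)
    then show ?thesis
    proof (cases rule: standard_or_least_tooth)
      case (standard k)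
      have "orth_poly (As @ {1..j} # Bs) = fund_weight j * orth_poly (As @ {} # Bs)"
        using sep by (intro "1.IH") (auto simp: Cons separated_Cons)
      then show ?thesis
        by (simp only: Cons standard append_Cons orth_poly_standard mult.left_commute)
    next
      case (tooth a)
      have a: "1 \<le> a" using tooth(1) by (simp add: missing_tooth_def)
      have sub: "row_subset a (C # As @ {1..j} # Bs)"
        using row_subset_head[OF sep tooth(1)] .
      then have "a \<in> {1..j} \<longrightarrow> Suc a \<in> {1..j}" unfolding row_subset_def by simp
      then have "a \<noteq> j" using a by auto
      then have fixed: "transpose a (Suc a) ` {1..j} = {1..j}"
        using a by (intro transpose_image_fixed) auto
      have "separated (swap_rows a (C # As @ {1..j} # Bs))"
        using separated_swap_rows[OF sep sub a] .
      then have "separated (swap_rows a (C # As) @ {1..j} # swap_rows a Bs)"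
        by (simp only: swap_rows_append swap_rows_Cons fixed append_Cons)
      then have "orth_poly (swap_rows a (C # As) @ {1..j} # swap_rows a Bs) =
          fund_weight j * orth_poly (swap_rows a (C # As) @ {} # swap_rows a Bs)"
        using C(1) tooth(1)
        by (intro "1.IH") (simp_all add: Cons sum_transpose_image_less missing_tooth_def)
      then show ?thesis
        using orth_poly_tooth[OF C(1) tooth, of "As @ {1..j} # Bs"]
          orth_poly_tooth[OF C(1) tooth, of "As @ {} # Bs"]
          demazure_bar_mult_symmetric[OF swap_vars_fund_weight[OF \<open>a \<noteq> j\<close> a]]
        by (simp only: Cons swap_rows_append swap_rows_Cons fixed append_Cons image_empty)
    qed
  qed
qed

text \<open>\<open>As\<close> collects the columns already treated, so that
  \<open>orth_poly_remove_standard\<close> can act at any position.\<close>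

lemma orth_poly_clear_cols:
  assumes "finite J" "0 \<notin> J" "separated (As @ Bs)"
  shows "orth_poly (As @ Bs) =
    (\<Prod>j\<in>J. fund_weight j ^ count_list Bs {1..j}) * orth_poly (As @ clear_cols J Bs)"
  using assms(3)
proof (induction Bs arbitrary: As)
  case Nil
  then show ?case by (simp add: clear_cols_def)
next
  case (Cons C Bs)
  show ?case
  proof (cases "\<exists>j\<in>J. C = {1..j}")
    case True
    then obtain j where j: "j \<in> J" "C = {1..j}" by blast
    \<comment> \<open>Since \<open>j\<close> is nonzero, the interval determines it, so the column
      contributes to exactly one factor of the product.\<close>
    have eq_iff: "{1..j} = {1..k} \<longleftrightarrow> k = j" for k
      using j(1) assms(2) by (cases "j = 0") (auto simp: Icc_eq_Icc)
    have clear: "clear_cols J (C # Bs) = {} # clear_cols J Bs"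
      using True by (simp add: clear_cols_def)
    have "(\<Prod>k\<in>J. fund_weight k ^ count_list (C # Bs) {1..k}) =
        (\<Prod>k\<in>J. (if k = j then fund_weight j else 1) * fund_weight k ^ count_list Bs {1..k})"
      by (intro prod.cong) (auto simp: j(2) eq_iff[unfolded One_nat_def])
    also have "\<dots> = fund_weight j * (\<Prod>k\<in>J. fund_weight k ^ count_list Bs {1..k})"
      using assms(1) j(1) by (simp add: prod.distrib)
    finally have "(\<Prod>k\<in>J. fund_weight k ^ count_list (C # Bs) {1..k}) =
        fund_weight j * (\<Prod>k\<in>J. fund_weight k ^ count_list Bs {1..k})" .
    moreover have "orth_poly (As @ C # Bs) = fund_weight j * orth_poly ((As @ [{}]) @ Bs)"
      using orth_poly_remove_standard[of As j Bs] Cons.prems by (simp add: j(2))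
    moreover have "orth_poly ((As @ [{}]) @ Bs) =
        (\<Prod>k\<in>J. fund_weight k ^ count_list Bs {1..k}) * orth_poly ((As @ [{}]) @ clear_cols J Bs)"
      using separated_clear[OF Cons.prems] by (intro Cons.IH) simp
    ultimately show ?thesis by (simp add: clear mult.assoc)
  next
    case False
    then have "count_list (C # Bs) {1..j} = count_list Bs {1..j}" if "j \<in> J" for j
      using that by auto
    moreover have clear: "clear_cols J (C # Bs) = C # clear_cols J Bs"
      using False by (auto simp: clear_cols_def)
    ultimately show ?thesis
      using Cons.IH[of "As @ [C]"] Cons.prems by (simp cong: prod.cong)
  qed
qed

lemma separated_clear_cols:
  assumes "separated Cs"
  shows "separated (clear_cols J Cs)"
proof -
  define f where "f = (\<lambda>C. if \<exists>j\<in>J. C = {1..j} then {} else C)"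
  have f: "f C = {} \<or> f C = C" for C by (simp add: f_def)
  have "sorted_wrt (\<lambda>C C'. \<forall>x\<in>f C - f C'. \<forall>y\<in>f C' - f C. x < y) Cs"
  proof (rule sorted_wrt_mono_rel)
    show "sorted_wrt (\<lambda>C C'. \<forall>x\<in>C - C'. \<forall>y\<in>C' - C. x < y) Cs"
      using assms by (simp add: separated_def)
    show "\<forall>x\<in>f C - f C'. \<forall>y\<in>f C' - f C. x < y"
      if "\<forall>x\<in>C - C'. \<forall>y\<in>C' - C. x < y" for C C'
      using that f[of C] f[of C'] by (elim disjE) simp_all
  qed
  moreover have "finite (f C) \<and> 0 \<notin> f C" if "C \<in> set Cs" for C
    using f[of C] assms that by (auto simp: separated_def)
  moreover have "clear_cols J Cs = map f Cs" by (simp add: clear_cols_def f_def)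
  ultimately show ?thesis by (simp add: separated_def sorted_wrt_map)
qed

section \<open>From column families to runs of the algorithm\<close>

lemma orth_poly_all_empty: "set Cs \<subseteq> {{}} \<Longrightarrow> orth_poly Cs = 1"
  by (induction Cs) simp_all

text \<open>One round of the algorithm is a swap followed by a clearing:
  \<open>orth_poly_swap_rows\<close> yields the operator and \<open>orth_poly_clear_cols\<close> the
  weight. \<open>no_standard\<close> ensures that the leftmost nonempty column has a tooth.\<close>

lemma orth_poly_orthodontia:
  assumes "orthodontia Cs is ms" "separated Cs" "no_standard Cs"
  shows "orth_poly Cs =
    foldr (\<lambda>(i, m) f. demazure_bar i (fund_weight i ^ m * f)) (zip is ms) 1"
  using assms
proof (induction rule: orthodontia.induct)
  case (stop Cs)
  then have "set Cs \<subseteq> {{}}" by blast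
  then show ?case by (simp add: orth_poly_all_empty)
next
  case (step Cs i Ds m "is" ms)
  obtain As C Bs where Cs: "Cs = As @ C # Bs" and C: "C \<noteq> {}" and As: "\<forall>A\<in>set As. A = {}"
    using split_list_first_prop[OF step.hyps(1)] by auto
  have As': "filter (\<lambda>C. C \<noteq> {}) As = []" using As by (auto simp: filter_empty_conv)
  have left: "leftmost Cs = C" using C by (simp add: leftmost_def Cs As')
  have sep: "separated (C # Bs)"
    using step.prems(1) by (auto simp: Cs separated_def sorted_wrt_append)
  have C': "finite C" "0 \<notin> C" using sep by (simp_all add: separated_Cons)
  have ex: "\<exists>a. missing_tooth C a"
  proof (rule missing_tooth_exists[OF C'])
    fix j show "C \<noteq> {1..j}"
      using step.prems(2) C by (cases j) (auto simp: no_standard_def Cs)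
  qed
  have tooth: "missing_tooth C i" "\<And>b. b < i \<Longrightarrow> \<not> missing_tooth C b"
    using LeastI_ex[OF ex] not_less_Least by (auto simp: step.hyps(2) left)
  have i: "1 \<le> i" using tooth(1) by (simp add: missing_tooth_def)
  have "row_subset i (C # Bs)" using row_subset_head[OF sep tooth(1)] .
  then have sub: "row_subset i Cs" using As by (auto simp: row_subset_def Cs)
  have sepD: "separated Ds"
    unfolding step.hyps(3) using separated_swap_rows[OF step.prems(1) sub i] .
  have "orth_poly Cs = demazure_bar i (orth_poly Ds)"
    unfolding step.hyps(3) using orth_poly_swap_rows[OF step.prems(1) sub i] .
  also have "orth_poly Ds = fund_weight i ^ m * orth_poly (clear_cols {i} Ds)"
    using orth_poly_clear_cols[of "{i}" "[]" Ds] sepD i by (simp add: step.hyps(4))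
  also have "orth_poly (clear_cols {i} Ds) =
      foldr (\<lambda>(i, m) f. demazure_bar i (fund_weight i ^ m * f)) (zip is ms) 1"
    using no_standard_step[OF step.prems(2) i] separated_clear_cols[OF sepD]
    by (intro step.IH) (simp_all add: step.hyps(3))
  finally show ?case by simp
qed

section \<open>Rothe diagrams\<close>

definition rothe_col :: "nat \<Rightarrow> (nat \<Rightarrow> nat) \<Rightarrow> nat \<Rightarrow> nat set" where
  "rothe_col n w c = {i. (i, c) \<in> rothe n w}"

lemma columns_rothe: "columns n (rothe n w) = map (rothe_col n w) [1..<Suc n]"
  by (simp add: columns_def rothe_col_def)

lemma mem_rothe_col:
  "i \<in> rothe_col n w c \<longleftrightarrow> 1 \<le> i \<and> i \<le> n \<and> 1 \<le> c \<and> c \<le> n \<and> i < inv w c \<and> c < w i"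
  by (auto simp: rothe_col_def rothe_def)

lemma rothe_col_subset: "rothe_col n w c \<subseteq> {1..n}"
  by (auto simp: mem_rothe_col)

text \<open>Let \<open>y\<close> lie only in the later column \<open>c'\<close>. Then
  \<open>c \<le> c' < w y\<close>, so \<open>y\<close> can be missing from column \<open>c\<close>
  only because \<open>inv w c \<le> y\<close>, whereas every \<open>x\<close> in column
  \<open>c\<close> satisfies \<open>x < inv w c\<close>.\<close>

lemma separated_map_rothe_col: "sorted cs \<Longrightarrow> separated (map (rothe_col n w) cs)"
proof (induction cs)
  case Nil
  then show ?case by (simp add: separated_def)
next
  case (Cons c cs)
  have "x < y" if "c' \<in> set cs" "x \<in> rothe_col n w c" "x \<notin> rothe_col n w c'"
    "y \<in> rothe_col n w c'" "y \<notin> rothe_col n w c" for c' x y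
  proof -
    have "c \<le> c'" using Cons.prems that by simp
    then show ?thesis using that(2-5) unfolding mem_rothe_col by linarith
  qed
  moreover have "finite (rothe_col n w c)" by (rule finite_subset[OF rothe_col_subset]) simp
  moreover have "0 \<notin> rothe_col n w c" by (simp add: mem_rothe_col)
  moreover have "separated (map (rothe_col n w) cs)" using Cons by simp
  ultimately show ?case unfolding list.map separated_Cons set_map by blast
qed

section \<open>Leading standard columns and the staircase of \<open>w0\<close>\<close>

lemma orth_poly_standard_prefix:
  "(\<And>c. c \<in> set cs \<Longrightarrow> F c = {1..h c}) \<Longrightarrow>
    orth_poly (map F cs @ Ds) = (\<Prod>c\<leftarrow>cs. fund_weight (h c)) * orth_poly Ds"
proof (induction cs)
  case (Cons c cs)
  have "F c = {1..h c}" using Cons.prems by simp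
  then show ?case using Cons by (simp only: list.map append_Cons orth_poly_standard) simp
qed simp

lemma prod_fund_weight_staircase:
  "(\<Prod>c=1..n. fund_weight (n - c)) = (\<Prod>i\<in>{1..<n}. X i ^ (n - i))"
proof (induction n)
  case 0
  then show ?case by simp
next
  case (Suc n)
  have "(\<Prod>c=1..Suc n. fund_weight (Suc n - c)) =
      fund_weight (Suc n - 1) * (\<Prod>c=Suc 1..Suc n. fund_weight (Suc n - c))"
    by (rule prod.atLeast_Suc_atMost) simp
  also have "\<dots> = fund_weight n * (\<Prod>c=1..n. fund_weight (n - c))"
    unfolding prod.atLeast_Suc_atMost_Suc_shift by simp
  \<comment> \<open>Extending the second product to \<open>i = n\<close> adds only the factor
    \<open>X n ^ 0\<close>.\<close>
  also have "\<dots> = (\<Prod>i\<in>{1..n}. X i) * (\<Prod>i\<in>{1..n}. X i ^ (n - i))"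
    unfolding Suc.IH fund_weight_def[of n]
    by (intro arg_cong2[where f = "(*)"] refl prod.mono_neutral_left) auto
  also have "\<dots> = (\<Prod>i\<in>{1..n}. X i ^ (Suc n - i))"
    unfolding prod.distrib[symmetric] by (intro prod.cong) (auto simp: Suc_diff_le)
  finally show ?case by (simp add: atLeastLessThanSuc_atLeastAtMost)
qed

text \<open>Column \<open>k\<close> is \<open>{1..p - 1}\<close> for \<open>w\<close> and
  \<open>{1..p}\<close> for \<open>v\<close>. The extra factor \<open>X p\<close> turns
  \<open>divdiff_bar p\<close> into \<open>demazure_bar p\<close> on the later columns; all
  remaining factors are symmetric in \<open>X p\<close> and \<open>X (Suc p)\<close>.\<close>

lemma orth_poly_rothe_ascent:
  assumes w: "w permutes {1..n}" and k: "1 \<le> k" "k \<le> n"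
    and last: "\<And>c. 1 \<le> c \<Longrightarrow> c < k \<Longrightarrow> w (n + 1 - c) = c"
    and neq: "w (n + 1 - k) \<noteq> k" and p: "w p = k"
  defines "v \<equiv> w \<circ> transpose p (Suc p)"
  shows "p \<in> {1..<n}" "w p < w (Suc p)"
    and "orth_poly (columns n (rothe n w)) =
      divdiff_bar p (orth_poly (columns n (rothe n v)))"
proof -
  have inj: "w x = w y \<longleftrightarrow> x = y" for x y using permutes_inj[OF w] by (auto dest: injD)
  have inv_w: "inv w c = x \<longleftrightarrow> w x = c" for c x
    using permutes_inverses[OF w] by metis
  have p_range: "1 \<le> p" "p \<le> n"
    using permutes_in_image[OF w, of p] k p by auto
  have p_neq: "p \<noteq> n + 1 - c" if "1 \<le> c" "c < k" for c
    using last[OF that] p that by auto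
  \<comment> \<open>The last \<open>k - 1\<close> positions hold the values below \<open>k\<close>,
    and \<open>neq\<close> excludes the position before them.\<close>
  have p_le: "p + k \<le> n"
  proof (rule ccontr)
    assume "\<not> p + k \<le> n"
    moreover have "p \<noteq> n + 1 - k" using neq p by auto
    ultimately have "p = n + 1 - (n + 1 - p)" "n + 1 - p < k" "1 \<le> n + 1 - p"
      using p_range by auto
    then show False using p_neq by blast
  qed
  then show p_in: "p \<in> {1..<n}" using p_range k by auto
  have big: "k \<le> w i" if "1 \<le> i" "i + k \<le> n + 1" for i
  proof (rule ccontr)
    assume less: "\<not> k \<le> w i"
    have "1 \<le> w i" using permutes_in_image[OF w, of i] that k by auto
    then have "w (n + 1 - w i) = w i" using last less by simp
    then have "n + 1 - w i = i" by (simp add: inj)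
    then show False using that less by linarith
  qed
  have "w (Suc p) \<noteq> w p" by (simp add: inj)
  then show asc: "w p < w (Suc p)" using big[of "Suc p"] p p_le p_range by simp
  have v: "v permutes {1..n}" unfolding v_def using comp_transpose_permutes[OF w p_in] .
  have inv_v: "inv v c = transpose p (Suc p) (inv w c)" for c
  proof -
    have "v (transpose p (Suc p) (inv w c)) = c"
      using permutes_inverses[OF w] by (simp add: v_def)
    then show ?thesis using permutes_inverses[OF v] by metis
  qed
  have small: "c < w i" if "1 \<le> c" "c < k" "1 \<le> i" "i < n + 1 - c" for c i
  proof (rule ccontr)
    assume less: "\<not> c < w i"
    have "1 \<le> w i" using permutes_in_image[OF w, of i] that k by auto
    then have "w (n + 1 - w i) = w i" using last less that by simp
    then have "n + 1 - w i = i" by (simp add: inj)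
    then show False using that less by linarith
  qed
  have inv_last: "inv w c = n + 1 - c" if "1 \<le> c" "c < k" for c
    using last[OF that] inv_w by simp
  have col_w: "rothe_col n w c = {1..n - c}" if "1 \<le> c" "c < k" for c
    using that k inv_last[OF that] small[OF that] by (auto simp: mem_rothe_col)
  have col_v: "rothe_col n v c = {1..n - c}" if c: "1 \<le> c" "c < k" for c
  proof -
    have fixed: "transpose p (Suc p) (n + 1 - c) = n + 1 - c"
      using c p_le by (auto simp: transpose_def)
    have "c < v i" if "1 \<le> i" "i < n + 1 - c" for i
      unfolding v_def comp_def using c p_le p_range that
      by (intro small) (auto simp: transpose_def)
    then show ?thesis
      using c k fixed by (auto simp: mem_rothe_col inv_v inv_last)
  qed
  have inv_k: "inv w k = p" using p inv_w by simp
  have gt: "k < w i" if "1 \<le> i" "i + k \<le> n + 1" "i \<noteq> p" for i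
    using big[OF that(1,2)] that(3) inj[of i p] p by auto
  have col_w_k: "rothe_col n w k = {1..p - 1}"
    using k p_le gt by (auto simp: mem_rothe_col inv_k)
  have col_v_k: "rothe_col n v k = {1..p}"
  proof -
    have "k < v i" if "1 \<le> i" "i \<le> p" for i
      unfolding v_def comp_def using that p_le by (intro gt) (auto simp: transpose_def)
    then show ?thesis
      using k p_le by (auto simp: mem_rothe_col inv_k inv_v)
  qed
  \<comment> \<open>If \<open>c\<close> stands at position \<open>Suc p\<close> in \<open>w\<close>,
    it moves to \<open>p\<close> in \<open>v\<close>, and a box in row \<open>p\<close> would be
    lost. There is none, since \<open>w p = k < c\<close>.\<close>
  have col_above: "rothe_col n v c = transpose p (Suc p) ` rothe_col n w c" if "k < c" for c
  proof (rule set_eqI)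
    fix i
    have "inv w c \<noteq> p" using inv_w p that by auto
    moreover have "\<not> c < w p" using p that by simp
    moreover have "v i = w (transpose p (Suc p) i)" by (simp add: v_def)
    ultimately show "i \<in> rothe_col n v c \<longleftrightarrow> i \<in> transpose p (Suc p) ` rothe_col n w c"
      unfolding mem_transpose_image mem_rothe_col inv_v using p_in
      by (auto simp: transpose_def)
  qed
  let ?pre = "\<Prod>c\<leftarrow>[1..<k]. fund_weight (n - c)"
  let ?T = "map (rothe_col n w) [Suc k..<Suc n]"
  have upt: "[1..<Suc n] = [1..<k] @ k # [Suc k..<Suc n]"
    using k upt_add_eq_append[of 1 k "Suc n - k"] upt_conv_Cons[of k "Suc n"]
    by (simp del: upt_Suc)
  have w_eq: "orth_poly (columns n (rothe n w)) = ?pre * (fund_weight (p - 1) * orth_poly ?T)"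
    unfolding columns_rothe upt map_append list.map col_w_k
    by (subst orth_poly_standard_prefix[where h = "\<lambda>c. n - c"])
      (simp_all add: col_w orth_poly_standard del: One_nat_def)
  have T_v: "map (rothe_col n v) [Suc k..<Suc n] = swap_rows p ?T"
    by (auto simp: swap_rows_def col_above)
  have v_eq: "orth_poly (columns n (rothe n v)) =
      ?pre * (fund_weight p * orth_poly (swap_rows p ?T))"
    unfolding columns_rothe upt map_append list.map col_v_k T_v
    by (subst orth_poly_standard_prefix[where h = "\<lambda>c. n - c"])
      (simp_all add: col_v orth_poly_standard del: One_nat_def)
  \<comment> \<open>The columns before \<open>k\<close> have length
    \<open>n - c > n - k \<ge> p\<close>, so none of them ends at row \<open>p\<close>.\<close>
  have sym_list: "swap_vars p (\<Prod>c\<leftarrow>cs. fund_weight (n - c)) = (\<Prod>c\<leftarrow>cs. fund_weight (n - c))"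
    if "\<And>c. c \<in> set cs \<Longrightarrow> c < k" for cs
    using that
  proof (induction cs)
    case (Cons c cs)
    then have "c < k" by simp
    then have "p \<noteq> n - c" using p_le by linarith
    then show ?case using Cons p_range by (simp add: swap_vars_mult swap_vars_fund_weight)
  qed simp
  have sym_pre: "swap_vars p ?pre = ?pre" by (rule sym_list) simp
  have sym_p: "swap_vars p (fund_weight (p - 1)) = fund_weight (p - 1)"
    using p_range by (intro swap_vars_fund_weight) auto
  have fw: "fund_weight p = fund_weight (p - 1) * X p"
    using fund_weight_Suc[of "p - 1"] p_range by simp
  have "row_subset p ?T"
    using p by (auto simp: row_subset_def mem_rothe_col)
  then have "orth_poly ?T = demazure_bar p (orth_poly (swap_rows p ?T))"
    using p_range by (intro orth_poly_swap_rows separated_map_rothe_col) (auto simp del: upt_Suc)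
  then show "orth_poly (columns n (rothe n w)) =
      divdiff_bar p (orth_poly (columns n (rothe n v)))"
    unfolding w_eq v_eq fw mult.assoc divdiff_bar_mult_symmetric[OF sym_pre]
      divdiff_bar_mult_symmetric[OF sym_p]
    by (simp add: demazure_bar_eq_divdiff_bar)
qed

text \<open>Follows one particular chain of ascents up to \<open>w0\<close>, the recursion for
  Grothendieck polynomials being valid at every ascent. \<open>weighted_sum\<close> decreases along
  the chain, which ends at the staircase diagram.\<close>

theorem grothendieck_eq_orth_poly:
  assumes "w permutes {1..n}"
  shows "grothendieck n w = orth_poly (columns n (rothe n w))"
  using assms
proof (induction "weighted_sum n w" arbitrary: w rule: less_induct)
  case less
  show ?case
  proof (cases "\<exists>k. 1 \<le> k \<and> k \<le> n \<and> w (n + 1 - k) \<noteq> k")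
    case True
    define k where "k = (LEAST k. 1 \<le> k \<and> k \<le> n \<and> w (n + 1 - k) \<noteq> k)"
    have k: "1 \<le> k" "k \<le> n" "w (n + 1 - k) \<noteq> k"
      using LeastI_ex[OF True] by (simp_all add: k_def)
    have last: "w (n + 1 - c) = c" if "1 \<le> c" "c < k" for c
      using not_less_Least[of c "\<lambda>k. 1 \<le> k \<and> k \<le> n \<and> w (n + 1 - k) \<noteq> k", folded k_def]
        that k(2)
      by simp
    define p where "p = inv w k"
    have p: "w p = k" unfolding p_def using permutes_inverses[OF less.prems] by simp
    note step = orth_poly_rothe_ascent[OF less.prems k(1,2) last k(3) p]
    show ?thesis
      using grothendieck_ascent[OF less.prems step(1,2)] step(3)
        less.hyps[OF weighted_sum_less[OF step(1,2)] comp_transpose_permutes[OF less.prems step(1)]]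
      by simp
  next
    case False
    have "w i = w0 n i" for i
    proof (cases "i \<in> {1..n}")
      case True
      then show ?thesis using False[simplified, rule_format, of "n + 1 - i"]
        by (auto simp: w0_def)
    next
      case outside: False
      then show ?thesis using permutes_not_in[OF less.prems] by (auto simp: w0_def)
    qed
    then have w: "w = w0 n" by blast
    have "rothe_col n (w0 n) c = {1..n - c}" if "c \<in> set [1..<Suc n]" for c
    proof -
      have "w0 n (n + 1 - c) = c" using that by (auto simp: w0_def)
      then have "inv (w0 n) c = n + 1 - c"
        using permutes_inverses[OF w0_permutes] by metis
      then show ?thesis using that by (auto simp: mem_rothe_col w0_def)
    qed
    then have "orth_poly (map (rothe_col n (w0 n)) [1..<Suc n] @ []) =
        (\<Prod>c\<leftarrow>[1..<Suc n]. fund_weight (n - c)) * orth_poly []"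
      by (rule orth_poly_standard_prefix)
    then
    have "orth_poly (columns n (rothe n w)) = (\<Prod>c\<leftarrow>[1..<Suc n]. fund_weight (n - c))"
      by (simp add: columns_rothe w del: upt_Suc)
    also have "\<dots> = (\<Prod>c=1..n. fund_weight (n - c))"
      by (subst prod.distinct_set_conv_list[symmetric])
        (simp_all add: atLeastLessThanSuc_atLeastAtMost del: upt_Suc)
    finally show ?thesis by (simp only: w grothendieck_w0 prod_fund_weight_staircase)
  qed
qed

theorem theorem1p1:
  fixes n :: nat and w :: "nat \<Rightarrow> nat" and "is" ks ms :: "nat list"
  assumes "w permutes {1..n}"
    and "orthodontic_sequence n w is ks ms"
  shows "grothendieck n w =
    (\<Prod>j=1..n. fund_weight j ^ (ks ! (j - 1))) *
    foldr (\<lambda>(i, m) f. demazure_bar i (fund_weight i ^ m * f)) (zip is ms) 1"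
proof -
  let ?Cs = "columns n (rothe n w)"
  have ks: "ks = map (\<lambda>j. count_list ?Cs {1..j}) [1..<Suc n]"
    and orth: "orthodontia (clear_cols {1..n} ?Cs) is ms"
    using assms(2) by (simp_all add: orthodontic_sequence_def)
  have sep: "separated ?Cs"
    unfolding columns_rothe by (rule separated_map_rothe_col) (simp del: upt_Suc)
  \<comment> \<open>Columns lie in \<open>{1..n}\<close>, so clearing the intervals up to
    \<open>n\<close> removes every nonempty standard column.\<close>
  have "no_standard (clear_cols {1..n} ?Cs)"
    unfolding no_standard_def
  proof
    fix E assume "E \<in> set (clear_cols {1..n} ?Cs)"
    then obtain C where C: "C \<in> set ?Cs"
      and E: "E = (if \<exists>j\<in>{1..n}. C = {1..j} then {} else C)"
      by (auto simp: clear_cols_def)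
    have sub: "C \<subseteq> {1..n}" using C rothe_col_subset by (auto simp: columns_rothe simp del: upt_Suc)
    have "C \<noteq> {1..j}" if "\<not> (\<exists>j\<in>{1..n}. C = {1..j})" "1 \<le> j" for j
      using that sub by auto
    then show "finite E \<and> 0 \<notin> E \<and> (\<forall>j\<ge>1. E \<noteq> {1..j})"
      using sub finite_subset[OF sub] by (auto simp: E)
  qed
  from orth_poly_orthodontia[OF orth separated_clear_cols[OF sep] this]
  have run: "orth_poly (clear_cols {1..n} ?Cs) =
      foldr (\<lambda>(i, m) f. demazure_bar i (fund_weight i ^ m * f)) (zip is ms) 1" .
  have "grothendieck n w = orth_poly ([] @ ?Cs)"
    using grothendieck_eq_orth_poly[OF assms(1)] by simp
  also have "\<dots> = (\<Prod>j=1..n. fund_weight j ^ count_list ?Cs {1..j}) *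
      orth_poly ([] @ clear_cols {1..n} ?Cs)"
    using sep by (intro orth_poly_clear_cols) simp_all
  also have "(\<Prod>j=1..n. fund_weight j ^ count_list ?Cs {1..j}) =
      (\<Prod>j=1..n. fund_weight j ^ (ks ! (j - 1)))"
    \<comment> \<open>\<open>ks\<close> starts with the entry for \<open>j = 1\<close> at list index
      0.\<close>
    by (intro prod.cong) (auto simp: ks nth_map simp del: upt_Suc)
  finally show ?thesis by (simp only: append_Nil run)
qed

end
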